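(* Let $e>1$ be odd, $t\ge0$ an integer and $\mathbf c=(t+(1-e)/2,0)$. Let $\mu$ be a bipartition such that $|\mu,\mathbf c\rangle$ is a highest weight vertex of the crystal graph $\mathcal G_{\mathbf c,e}$. Then the $e$-core of $\Phi_t(\mu)$ is a $2$-core.
   Context: Crystal graph $\mathcal G_{\mathbf c,e}$ ($\mathbf c=(c_1,c_2)$): vertices $|\mu,\mathbf c\rangle$, $\mu$ a bipartition. Nodes $(a,b,j)$ with $(a,b)$ in the Young diagram of $\mu^j$ (row $a$, column $b$), content $b-a+c_j$, residue = content mod $e$; addable/removable nodes as usual. For residue $i$, order addable and removable $i$-nodes by increasing content, ties broken by putting larger component index $j$ first; form the word in $A$ (addable) and $R$ (removable), cancel consecutive $RA$ recursively to get $A^\alpha R^\beta$; the good addable $i$-node (if $\alpha>0$) is the node of the rightmost $A$. Edge $|\mu,\mathbf c\rangle\xrightarrow{i}|\nu,\mathbf c\rangle$ iff $\nu$ is $\mu$ plus its good addable $i$-node. A highest weight vertex is one with no incoming edge. $\Delta_t=(t,\dots,1)$. For a partition $\lambda$ with $\beta$-set $B$ of odd size, $\lambda^{(2)}=(\pi\{x/2: x\in B\text{ even}\},\pi\{(x-1)/2:x\in B\text{ odd}\})$ with $\pi(X)$ the partition with $\beta$-set $X$; if the $2$-core of $\lambda$ is $\Delta_t$, $\bar\lambda^{(2)}$ equals $\lambda^{(2)}$ for $t$ even and the swapped pair for $t$ odd. $\Phi_t(\mu)$ is the unique partition with $2$-core $\Delta_t$ and $\bar\lambda^{(2)}=\mu$.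 *)

theory Defs
  imports Main
begin

definition is_partition :: "nat list \<Rightarrow> bool" where
  "is_partition la \<longleftrightarrow> sorted_wrt (\<ge>) la \<and> 0 \<notin> set la"

definition part :: "nat list \<Rightarrow> nat \<Rightarrow> nat" where
  "part la a = (if 1 \<le> a \<and> a \<le> length la then la ! (a - 1) else 0)"

type_synonym bipartition = "nat list \<times> nat list"

definition is_bipartition :: "bipartition \<Rightarrow> bool" where
  "is_bipartition mu \<longleftrightarrow> is_partition (fst mu) \<and> is_partition (snd mu)"

definition comp :: "bipartition \<Rightarrow> nat \<Rightarrow> nat list" where
  "comp mu j = (if j = 1 then fst mu else snd mu)"

definition chg :: "int \<times> int \<Rightarrow> nat \<Rightarrow> int" where
  "chg c j = (if j = 1 then fst c else snd c)"

definition staircase :: "nat \<Rightarrow> nat list" where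
  "staircase t = rev [1..<t+1]"

definition conj_part :: "nat list \<Rightarrow> nat \<Rightarrow> nat" where
  "conj_part la b = length (filter (\<lambda>x. b \<le> x) la)"

definition hook :: "nat list \<Rightarrow> nat \<Rightarrow> nat \<Rightarrow> nat" where
  "hook la a b = (part la a - b) + (conj_part la b - a) + 1"

definition is_core :: "nat \<Rightarrow> nat list \<Rightarrow> bool" where
  "is_core e la \<longleftrightarrow> (\<forall>a b. 1 \<le> a \<and> a \<le> length la \<and> 1 \<le> b \<and> b \<le> part la a \<longrightarrow> hook la a b \<noteq> e)"

text \<open>beta-set of size r (r \<ge> length): {lambda_i + r - i : 1 \<le> i \<le> r}.\<close>
definition beta :: "nat \<Rightarrow> nat list \<Rightarrow> nat set" where
  "beta r la = {part la i + r - i | i. 1 \<le> i \<and> i \<le> r}"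

definition part_of_beta :: "nat set \<Rightarrow> nat list" where
  "part_of_beta X = (let xs = rev (sorted_list_of_set X); k = length xs in
     filter (\<lambda>x. 0 < x) (map (\<lambda>i. xs ! i - (k - 1 - i)) [0..<k]))"

text \<open>The e-core, via the James abacus: push all beads on each runner up.\<close>
definition core :: "nat \<Rightarrow> nat list \<Rightarrow> nat list" where
  "core e la = (let B = beta (length la) la in
     part_of_beta {r + e * m | r m. r < e \<and> m < card {x \<in> B. x mod e = r}})"

definition odd_beta :: "nat list \<Rightarrow> nat set" where
  "odd_beta la = beta (if odd (length la) then length la else length la + 1) la"

definition quot2 :: "nat list \<Rightarrow> bipartition" where
  "quot2 la = (part_of_beta {x div 2 | x. x \<in> odd_beta la \<and> even x},
               part_of_beta {(x - 1) div 2 | x. x \<in> odd_beta la \<and> odd x})"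

definition barquot2 :: "nat \<Rightarrow> nat list \<Rightarrow> bipartition" where
  "barquot2 t la = (if even t then quot2 la else prod.swap (quot2 la))"

definition Phi :: "nat \<Rightarrow> bipartition \<Rightarrow> nat list" where
  "Phi t mu = (THE la. is_partition la \<and> core 2 la = staircase t \<and> barquot2 t la = mu)"

type_synonym node = "nat \<times> nat \<times> nat"  (* (row a, column b, component j) *)

definition addable :: "nat list \<Rightarrow> (nat \<times> nat) list" where
  "addable la = map (\<lambda>a. (a, part la a + 1))
     (filter (\<lambda>a. a = 1 \<or> part la (a - 1) > part la a) [1..<length la + 2])"

definition removable :: "nat list \<Rightarrow> (nat \<times> nat) list" where
  "removable la = map (\<lambda>a. (a, part la a))
     (filter (\<lambda>a. part la a > part la (a + 1)) [1..<length la + 1])"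

definition content :: "int \<times> int \<Rightarrow> node \<Rightarrow> int" where
  "content c n = (case n of (a, b, j) \<Rightarrow> int b - int a + chg c j)"

definition residue :: "nat \<Rightarrow> int \<times> int \<Rightarrow> node \<Rightarrow> int" where
  "residue e c n = content c n mod int e"

definition nodes_of :: "((nat \<times> nat) list) \<Rightarrow> nat \<Rightarrow> node list" where
  "nodes_of ns j = map (\<lambda>(a, b). (a, b, j)) ns"

text \<open>The word of addable (True) and removable (False) i-nodes, ordered by increasing
  content, ties broken by putting the larger component index first.\<close>
definition sig_word :: "int \<times> int \<Rightarrow> nat \<Rightarrow> nat \<Rightarrow> bipartition \<Rightarrow> (bool \<times> node) list" where
  "sig_word c e i mu =
     sort_key (\<lambda>(_, n). 2 * content c n + (2 - int (snd (snd n))))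
       (filter (\<lambda>(_, n). residue e c n = int i)
         (map (\<lambda>n. (True, n)) (nodes_of (addable (comp mu 1)) 1 @ nodes_of (addable (comp mu 2)) 2)
          @ map (\<lambda>n. (False, n)) (nodes_of (removable (comp mu 1)) 1 @ nodes_of (removable (comp mu 2)) 2)))"

fun cancel_RA :: "(bool \<times> 'a) list \<Rightarrow> (bool \<times> 'a) list \<Rightarrow> (bool \<times> 'a) list" where
  "cancel_RA st [] = rev st"
| "cancel_RA ((False, r) # st) ((True, x) # w) = cancel_RA st w"
| "cancel_RA st (x # w) = cancel_RA (x # st) w"

definition good_addable :: "int \<times> int \<Rightarrow> nat \<Rightarrow> nat \<Rightarrow> bipartition \<Rightarrow> node option" where
  "good_addable c e i mu =
     (let As = filter fst (cancel_RA [] (sig_word c e i mu)) in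
      if As = [] then None else Some (snd (last As)))"

definition add_box :: "nat list \<Rightarrow> nat \<Rightarrow> nat list" where
  "add_box la a = (if a = length la + 1 then la @ [1] else la[a - 1 := la ! (a - 1) + 1])"

definition add_node :: "bipartition \<Rightarrow> node \<Rightarrow> bipartition" where
  "add_node mu n = (case n of (a, b, j) \<Rightarrow>
     if j = 1 then (add_box (fst mu) a, snd mu) else (fst mu, add_box (snd mu) a))"

definition crystal_edge :: "int \<times> int \<Rightarrow> nat \<Rightarrow> bipartition \<Rightarrow> nat \<Rightarrow> bipartition \<Rightarrow> bool" where
  "crystal_edge c e mu i nu \<longleftrightarrow>
     i < e \<and> (\<exists>n. good_addable c e i mu = Some n \<and> nu = add_node mu n)"

definition highest_weight :: "int \<times> int \<Rightarrow> nat \<Rightarrow> bipartition \<Rightarrow> bool" where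
  "highest_weight c e mu \<longleftrightarrow> is_bipartition mu \<and>
     \<not> (\<exists>nu i. is_bipartition nu \<and> crystal_edge c e nu i mu)"

end

(* Encode a partition la by its bead positions {la_a - a}. Interleaving the beads of the two
components of mu gives the beads of Phi_t(mu), and the charge c is chosen such that the order on
the i-nodes of mu becomes the left-to-right order along a runner of the e-abacus of Phi_t(mu), an
addable or removable node being a bead that can move between z - 2 and z. In a highest weight vertex
every R of the signature is cancelled by an A to its right, that is, each final segment of a word
has at least as many A's as R's. Summed along a runner: the number of beads weakly to the right of z
on the runner of z is at most the same number for z - 2. Far to the left these numbers determine
the e-core, and the inequality says that its set of beads is closed under z -> z - 2. *)

theory Submission
  imports Defs
begin

section \<open>Partitions and maya diagrams\<close>

text \<open>Bead sets range over all integers because the definitions use beta-sets of different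
  sizes: \<open>core\<close> takes \<open>length la\<close> beads, \<open>quot2\<close> an odd
  number, each quotient component its own number. In infinite diagrams these differ only by shifts.
  The summand (1 - e)/2 of the charge puts a node of component 1 exactly e ahead of a node of
  component 2 with the same content, so on the same runner; that e is odd makes it an integer and
  makes doubling invertible modulo e, so that each runner carries one residue. The obstacle in using
  highest weight is that edges are given by adding a good node, while the hypothesis denies
  predecessors: from a final segment with too many R's a predecessor has to be built by turning one
  R into an A, and the signature of that predecessor has to be known.\<close>

lemma part_Cons: "part (x # xs) a = (if a = 1 then x else part xs (a - 1))"
  by (auto simp: part_def nth_Cons')

lemma part_antimono:
  assumes "is_partition la" "1 \<le> a" "a \<le> b"
  shows "part la b \<le> part la a"
proof (cases "a < b \<and> b \<le> length la")
  case True
  then show ?thesis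
    using assms sorted_wrt_nth_less[of "(\<ge>)" la "a - 1" "b - 1"]
    by (auto simp: is_partition_def part_def)
next
  case False
  then show ?thesis using assms by (auto simp: part_def)
qed

lemma part_strict:
  assumes "is_partition la" "1 \<le> a" "a < b"
  shows "int (part la b) - int b < int (part la a) - int a"
  using part_antimono[of la a b] assms by simp

lemma part_pos_iff:
  assumes "is_partition la" "1 \<le> a"
  shows "0 < part la a \<longleftrightarrow> a \<le> length la"
proof -
  have "a \<le> length la \<Longrightarrow> la ! (a - 1) \<in> set la" using assms by (intro nth_mem) simp
  then have "a \<le> length la \<Longrightarrow> 0 < la ! (a - 1)" using assms by (metis gr0I is_partition_def)
  then show ?thesis using assms by (auto simp: part_def)
qed

lemma part_eqI:
  assumes "is_partition la" "is_partition lb" "\<And>a. 1 \<le> a \<Longrightarrow> part la a = part lb a"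
  shows "la = lb"
proof -
  have iff: "a \<le> length la \<longleftrightarrow> a \<le> length lb" if "1 \<le> a" for a
    using part_pos_iff[OF assms(1) that] part_pos_iff[OF assms(2) that] assms(3)[OF that] by simp
  have len: "length la = length lb"
    using iff[of "length la"] iff[of "length lb"] by (cases la; cases lb) auto
  show ?thesis
  proof (rule nth_equalityI[OF len])
    fix i assume "i < length la"
    then show "la ! i = lb ! i" using assms(3)[of "i + 1"] len by (simp add: part_def)
  qed
qed

lemma part_ge_iff_conj:
  assumes "sorted_wrt (\<ge>) la" "1 \<le> b" "1 \<le> i"
  shows "b \<le> part la i \<longleftrightarrow> i \<le> conj_part la b"
  using assms(1,3)
proof (induction la arbitrary: i)
  case Nil
  then show ?case using assms(2) by (simp add: part_def conj_part_def)
next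
  case (Cons x xs)
  have IH: "b \<le> part xs (i - 1) \<longleftrightarrow> i - 1 \<le> conj_part xs b" if "i \<noteq> 1"
    using Cons that by simp
  show ?case
  proof (cases "b \<le> x")
    case True
    then show ?thesis using IH Cons.prems by (auto simp: part_Cons conj_part_def)
  next
    case False
    then have "filter ((\<le>) b) xs = []" using Cons.prems by (fastforce simp: filter_empty_conv)
    then show ?thesis using IH Cons.prems False by (auto simp: part_Cons conj_part_def)
  qed
qed

definition maya :: "nat list \<Rightarrow> int set" where
  "maya la = {int (part la a) - int a | a. 1 \<le> a}"

lemma mayaI: "1 \<le> a \<Longrightarrow> int (part la a) - int a \<in> maya la"
  by (auto simp: maya_def)

text \<open>Induction step of \<open>maya_inj\<close>: the bead of row \<open>a\<close> of
  \<open>la\<close> belongs to some row \<open>b\<close> of \<open>lb\<close>. No row above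
  \<open>a\<close> qualifies, since the beads there agree with earlier beads of \<open>la\<close>,
  which are strictly larger.\<close>

lemma maya_le_imp_part_le:
  assumes "is_partition la" "is_partition lb" "maya la = maya lb"
    and "1 \<le> a" "\<And>i. 1 \<le> i \<Longrightarrow> i < a \<Longrightarrow> part la i = part lb i"
  shows "part la a \<le> part lb a"
proof -
  have "int (part la a) - int a \<in> maya lb" using mayaI[OF assms(4)] assms(3) by blast
  then obtain b where b: "1 \<le> b" "int (part la a) - int a = int (part lb b) - int b"
    by (auto simp: maya_def)
  have "\<not> b < a"
    using part_strict[OF assms(1) b(1)] b assms(5)[of b] by fastforce
  then show ?thesis using part_antimono[OF assms(2,4), of b] b(2) by simp
qed

lemma maya_inj:
  assumes "is_partition la" "is_partition lb" "maya la = maya lb"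
  shows "la = lb"
proof (rule part_eqI[OF assms(1,2)])
  fix a :: nat assume "1 \<le> a"
  then show "part la a = part lb a"
  proof (induction a rule: less_induct)
    case (less a)
    then show ?case
      using maya_le_imp_part_le[OF assms less(2)]
        maya_le_imp_part_le[OF assms(2,1) assms(3)[symmetric] less(2)]
      by (simp add: order_antisym)
  qed
qed

section \<open>Finite beta-sets inside infinite bead diagrams\<close>

definition fill :: "nat set \<Rightarrow> int set" where
  "fill X = {z. z < 0 \<or> nat z \<in> X}"

text \<open>The rows beyond \<open>r\<close> are empty; their beads -a, shifted by \<open>r\<close>,
  occupy exactly the negative integers that \<open>fill\<close> adds.\<close>

lemma fill_beta:
  assumes "length la \<le> r"
  shows "z + int r \<in> fill (beta r la) \<longleftrightarrow> z \<in> maya la"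
proof
  assume L: "z + int r \<in> fill (beta r la)"
  show "z \<in> maya la"
  proof (cases "z + int r < 0")
    case True
    then have "length la < nat (- z)" using assms by linarith
    then have "part la (nat (- z)) = 0" by (simp add: part_def)
    then show ?thesis using mayaI[of "nat (-z)" la] True by simp
  next
    case False
    then obtain i where i: "1 \<le> i" "i \<le> r" "nat (z + int r) = part la i + r - i"
      using L by (auto simp: fill_def beta_def)
    then have "z = int (part la i) - int i" using False by linarith
    then show ?thesis using mayaI[OF i(1)] by simp
  qed
next
  assume "z \<in> maya la"
  then obtain a where a: "1 \<le> a" "z = int (part la a) - int a" by (auto simp: maya_def)
  show "z + int r \<in> fill (beta r la)"
  proof (cases "a \<le> r")
    case True
    then have "nat (z + int r) = part la a + r - a" using a by linarith
    then show ?thesis using True a(1) by (auto simp: fill_def beta_def)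
  next
    case False
    then show ?thesis using a assms by (simp add: fill_def part_def)
  qed
qed

lemma mem_beta_iff:
  assumes "length la \<le> r"
  shows "x \<in> beta r la \<longleftrightarrow> int x - int r \<in> maya la"
  using fill_beta[OF assms, of "int x - int r"] by (simp add: fill_def)

lemma beta_eq_image: "beta r la = (\<lambda>i. part la i + r - i) ` {1..r}"
  by (auto simp: beta_def)

lemma finite_beta [simp]: "finite (beta r la)"
  by (simp add: beta_eq_image)

lemma card_beta:
  assumes "is_partition la"
  shows "card (beta r la) = r"
proof -
  have "inj_on (\<lambda>i. part la i + r - i) {1..r}"
  proof (rule linorder_inj_onI)
    fix i j assume "i < j" "i \<in> {1..r}" "j \<in> {1..r}"
    then show "part la i + r - i \<noteq> part la j + r - j"
      using part_strict[OF assms, of i j] by auto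
  qed auto
  then show ?thesis by (simp add: beta_eq_image card_image)
qed

text \<open>Counting beads recovers the shift: in the beta-set of \<open>la\<close> with
  \<open>R\<close> beads, a copy of \<open>X\<close> sits above a solid block of
  \<open>R - k\<close> beads.\<close>

lemma maya_charge_unique:
  assumes "is_partition la" "finite X" "\<And>w. w \<in> maya la \<longleftrightarrow> w + k \<in> fill X"
  shows "k = int (card X)"
proof -
  \<comment> \<open>Large enough for \<open>beta R la\<close> to contain every row and for
    \<open>R - k\<close> to be nonnegative.\<close>
  define R where "R = max (length la) (nat \<bar>k\<bar>)"
  define s where "s = nat (int R - k)"
  have s: "int s = int R - k" by (auto simp: s_def R_def)
  have R: "length la \<le> R" by (simp add: R_def)
  have "x \<in> beta R la \<longleftrightarrow> x < s \<or> (\<exists>y\<in>X. x = y + s)" for x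
  proof -
    have "x \<in> beta R la \<longleftrightarrow> int x - int s < 0 \<or> nat (int x - int s) \<in> X"
    proof -
      have "int x - int R + k = int x - int s" using s by simp
      then show ?thesis unfolding mem_beta_iff[OF R] assms(3)[of "int x - int R"] by (simp only: fill_def mem_Collect_eq)
    qed
    also have "\<dots> \<longleftrightarrow> x < s \<or> (\<exists>y\<in>X. x = y + s)"
    proof (cases "x < s")
      case False
      then have "nat (int x - int s) = x - s" by simp
      then have "nat (int x - int s) \<in> X \<longleftrightarrow> (\<exists>y\<in>X. x = y + s)"
        using False by (metis add_diff_cancel_right' le_add_diff_inverse2 not_less)
      then show ?thesis using False by simp
    qed simp
    finally show ?thesis .
  qed
  then have "beta R la = {..<s} \<union> (\<lambda>y. y + s) ` X" by blast
  then have "R = card ({..<s} \<union> (\<lambda>y. y + s) ` X)" using card_beta[OF assms(1), of R] by simp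
  also have "\<dots> = s + card X"
    using assms(2) by (subst card_Un_disjoint) (auto simp: card_image inj_on_def)
  finally show ?thesis using s by simp
qed

lemma maya_shift_zero:
  assumes "is_partition la" "is_partition lb" "\<And>w. w \<in> maya la \<longleftrightarrow> w + k \<in> maya lb"
  shows "k = 0"
proof -
  have "w \<in> maya la \<longleftrightarrow> w + (k + int (length lb)) \<in> fill (beta (length lb) lb)" for w
    using fill_beta[of lb "length lb" "w + k"] assms(3) by (simp add: algebra_simps)
  from maya_charge_unique[OF assms(1) finite_beta this] show ?thesis
    using card_beta[OF assms(2)] by simp
qed

lemma sorted_less_nth_diff:
  fixes S :: "nat list"
  assumes "sorted_wrt (<) S" "p \<le> q" "q < length S"
  shows "S ! p + (q - p) \<le> S ! q"
  using assms(2,3)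
proof (induction q rule: dec_induct)
  case (step n)
  then have "S ! n < S ! Suc n" using assms(1) by (simp add: sorted_wrt_iff_nth_less)
  then show ?case using step by simp
qed simp

text \<open>The zeros of a weakly decreasing list form a tail, where \<open>part\<close> returns 0
  anyway, so dropping them moves no index.\<close>

lemma part_filter_pos:
  assumes "sorted_wrt (\<ge>) ys"
  shows "part (filter (\<lambda>x. 0 < x) ys) a = part ys a"
  using assms
proof (induction ys arbitrary: a)
  case (Cons y ys)
  show ?case
  proof (cases "0 < y")
    case True
    then show ?thesis using Cons by (simp add: part_Cons)
  next
    case False
    then have *: "\<forall>x\<in>set (y # ys). x = 0" using Cons.prems by auto
    then have "filter (\<lambda>x. 0 < x) (y # ys) = []" by (auto simp: filter_empty_conv)
    moreover have "part (y # ys) a = 0"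
      using * nth_mem[of "a - 1" "y # ys"] by (auto simp: part_def simp del: nth_mem)
    ultimately show ?thesis by (simp add: part_def)
  qed
qed simp

text \<open>The a-th largest element x of \<open>X\<close> has k - a elements of \<open>X\<close>
  below it, where k is \<open>card X\<close>. Its part is x - (k - a) and its bead x - k, so the
  shift by \<open>card X\<close> restores \<open>X\<close>.\<close>

lemma
  assumes "finite X"
  shows is_partition_part_of_beta: "is_partition (part_of_beta X)"
    and maya_part_of_beta: "z \<in> maya (part_of_beta X) \<longleftrightarrow> z + int (card X) \<in> fill X"
proof -
  define S where "S = sorted_list_of_set X"
  define k where "k = card X"
  have S: "sorted_wrt (<) S" "set S = X" "length S = k"
    using assms by (auto simp: S_def k_def)
  define ys where "ys = map (\<lambda>i. rev S ! i - (k - 1 - i)) [0..<k]"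
  have ys: "part_of_beta X = filter (\<lambda>x. 0 < x) ys"
    by (simp add: part_of_beta_def Let_def ys_def S(3) flip: S_def)
  have rev: "rev S ! i = S ! (k - 1 - i)" if "i < k" for i
    using that S(3) by (simp add: rev_nth)
  have sorted: "sorted_wrt (\<ge>) ys"
  proof -
    have *: "rev S ! j - (k - 1 - j) \<le> rev S ! i - (k - 1 - i)" if "i < j" "j < k" for i j
    proof -
      define p d where "p = k - 1 - j" and "d = j - i"
      have pd: "k - 1 - j = p" "k - 1 - i = p + d" "p + d < k" using that by (auto simp: p_def d_def)
      have "S ! p + d \<le> S ! (p + d)"
        using sorted_less_nth_diff[OF S(1), of p "p + d"] pd(3) S(3) by simp
      moreover have "rev S ! i = S ! (p + d)" "rev S ! j = S ! p" using that rev pd by auto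
      ultimately show ?thesis unfolding pd by linarith
    qed
    show ?thesis unfolding sorted_wrt_iff_nth_less
    proof (intro allI impI)
      fix i j assume ij: "i < j" "j < length ys"
      then have "j < k" by (simp add: ys_def)
      moreover have "ys ! i = rev S ! i - (k - 1 - i)" "ys ! j = rev S ! j - (k - 1 - j)"
        using ij by (simp_all add: ys_def del: diff_diff_left)
      ultimately show "ys ! j \<le> ys ! i" using *[of i j] ij(1) by metis
    qed
  qed
  show "is_partition (part_of_beta X)"
    using sorted by (simp add: is_partition_def ys sorted_wrt_filter)
  have part1: "int (part (part_of_beta X) a) - int a = int (S ! (k - a)) - int k" if a: "1 \<le> a" "a \<le> k" for a
  proof -
    define q where "q = k - a"
    have q: "k - 1 - (a - 1) = q" "k - a = q" "q < k" "int q = int k - int a" "a - 1 < k"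
      using a by (auto simp: q_def)
    have "part (part_of_beta X) a = ys ! (a - 1)"
      unfolding ys part_filter_pos[OF sorted] using a by (simp add: part_def ys_def)
    also have "\<dots> = rev S ! (a - 1) - (k - 1 - (a - 1))"
      using q(5) unfolding ys_def by simp
    also have "\<dots> = S ! q - q" unfolding rev[OF q(5)] q(1) ..
    finally show ?thesis
      using sorted_less_nth_diff[OF S(1), of 0 q] q S(3) by simp
  qed
  have part2: "part (part_of_beta X) a = 0" if "k < a" for a
    using that by (simp add: ys part_filter_pos[OF sorted]) (simp add: part_def ys_def)
  show "z \<in> maya (part_of_beta X) \<longleftrightarrow> z + int (card X) \<in> fill X"
  proof
    assume "z \<in> maya (part_of_beta X)"
    then obtain a where a: "1 \<le> a" "z = int (part (part_of_beta X) a) - int a"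
      by (auto simp: maya_def)
    show "z + int (card X) \<in> fill X"
    proof (cases "a \<le> k")
      case True
      then have "z + int k = int (S ! (k - a))" "S ! (k - a) \<in> X"
        using part1[of a] a S nth_mem[of "k - a" S] by auto
      then show ?thesis by (simp add: fill_def k_def)
    next
      case False
      then show ?thesis using part2[of a] a by (simp add: fill_def k_def)
    qed
  next
    assume L: "z + int (card X) \<in> fill X"
    show "z \<in> maya (part_of_beta X)"
    proof (cases "z + int k < 0")
      case True
      then show ?thesis using mayaI[of "nat (-z)" "part_of_beta X"] part2[of "nat (-z)"] by simp
    next
      case False
      then have "nat (z + int k) \<in> set S" using L S by (simp add: fill_def k_def)
      then obtain p where p: "p < k" "S ! p = nat (z + int k)" using S(3) by (auto simp: in_set_conv_nth)
      then have "z = int (S ! (k - (k - p))) - int k" using False by simp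
      moreover have "1 \<le> k - p" using p(1) by simp
      ultimately show ?thesis
        using part1[of "k - p"] mayaI[of "k - p" "part_of_beta X"] by (metis diff_le_self)
    qed
  qed
qed

section \<open>Cores\<close>

text \<open>A hook of length 2 is a removable domino, horizontal or vertical, and removing it would
  move a bead from some z to a vacant z - 2.\<close>

lemma is_core_2I:
  assumes la: "is_partition la" and closed: "\<And>z. z \<in> maya la \<Longrightarrow> z - 2 \<in> maya la"
  shows "is_core 2 la"
  unfolding is_core_def
proof (intro allI impI notI)
  fix a b assume ab: "1 \<le> a \<and> a \<le> length la \<and> 1 \<le> b \<and> b \<le> part la a" and h: "hook la a b = 2"
  have conj: "b \<le> part la i \<longleftrightarrow> i \<le> conj_part la b" if "1 \<le> i" for i
    using part_ge_iff_conj[of la b i] la ab that by (simp add: is_partition_def)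
  obtain i where i: "1 \<le> i" "int (part la a) - int a - 2 = int (part la i) - int i"
    using closed[OF mayaI[of a la]] ab by (auto simp: maya_def)
  have "a \<le> conj_part la b" using conj[of a] ab by simp
  \<comment> \<open>Arm 1 and leg 0, or arm 0 and leg 1. If z is the bead of row \<open>a\<close>,
    the rows up to \<open>a\<close> (respectively \<open>a + 1\<close>) have beads above z - 2, and
    all later beads are at most z - 3.\<close>
  then consider "part la a = b + 1" "conj_part la b = a" | "part la a = b" "conj_part la b = a + 1"
    using h ab unfolding hook_def by linarith
  then show False
  proof cases
    case 1
    then have "part la (a + 1) < b" using conj[of "a + 1"] by simp
    moreover have "i \<le> a \<Longrightarrow> part la a \<le> part la i" "a + 1 \<le> i \<Longrightarrow> part la i \<le> part la (a + 1)"
      using part_antimono[OF la] i ab by auto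
    ultimately show False using i 1 by (cases "i \<le> a") auto
  next
    case 2
    then have "part la (a + 2) < b" "b \<le> part la (a + 1)" using conj[of "a + 2"] conj[of "a + 1"] by auto
    moreover have "i \<le> a + 1 \<Longrightarrow> part la (a + 1) \<le> part la i" "a + 2 \<le> i \<Longrightarrow> part la i \<le> part la (a + 2)"
      using part_antimono[OF la] i ab by auto
    ultimately show False using i 2 by (cases "i \<le> a + 1") auto
  qed
qed

lemma is_core_2_part_of_beta:
  assumes "finite X" "\<And>x. x \<in> X \<Longrightarrow> 2 \<le> x \<Longrightarrow> x - 2 \<in> X"
  shows "is_core 2 (part_of_beta X)"
proof (rule is_core_2I[OF is_partition_part_of_beta[OF assms(1)]])
  fix z assume "z \<in> maya (part_of_beta X)"
  then have *: "z + int (card X) \<in> fill X" using maya_part_of_beta[OF assms(1)] by simp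
  have "nat (z + int (card X) - 2) \<in> X" if "\<not> z + int (card X) - 2 < 0"
    using assms(2)[of "nat (z + int (card X))"] that * by (auto simp: fill_def nat_diff_distrib')
  then show "z - 2 \<in> maya (part_of_beta X)"
    using maya_part_of_beta[OF assms(1), of "z - 2"] by (auto simp: fill_def algebra_simps)
qed

section \<open>Runner counts and the e-core\<close>

definition runner_count :: "nat \<Rightarrow> int set \<Rightarrow> int \<Rightarrow> nat" where
  "runner_count e M z = card {w \<in> M. z \<le> w \<and> w mod int e = z mod int e}"

lemma finite_maya_ge:
  assumes "is_partition la"
  shows "finite {w \<in> maya la. z \<le> w}"
proof (rule finite_subset)
  show "{w \<in> maya la. z \<le> w} \<subseteq> {z..int (part la 1) - 1}"
    using part_antimono[OF assms, of 1] by (fastforce simp: maya_def)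
qed simp

text \<open>A bead \<open>x\<close> with \<open>x mod e = r\<close> satisfies
  \<open>x \<ge> r\<close>, so \<open>r - length la\<close> is far enough to the left for the count
  to include every bead of the finite abacus on that runner.\<close>

lemma runner_count_beta:
  assumes "r < e"
  shows "card {x \<in> beta (length la) la. x mod e = r} = runner_count e (maya la) (int r - int (length la))"
proof -
  let ?L = "int (length la)"
  have "{w \<in> maya la. int r - ?L \<le> w \<and> w mod int e = (int r - ?L) mod int e}
      = (\<lambda>x. int x - ?L) ` {x \<in> beta (length la) la. x mod e = r}" (is "?A = ?B")
  proof
    show "?A \<subseteq> ?B"
    proof
      fix w assume w: "w \<in> ?A"
      let ?x = "nat (w + ?L)"
      have x: "int ?x = w + ?L" using w by simp
      have "(w + ?L) mod int e = int r mod int e"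
        using w mod_add_cong[of w "int e" "int r - ?L" ?L ?L] by simp
      then have "?x mod e = r" using x assms by (metis mod_less of_nat_eq_iff zmod_int)
      moreover have "?x \<in> beta (length la) la" using w x by (subst mem_beta_iff) auto
      ultimately show "w \<in> ?B" using x by (intro image_eqI[of _ _ ?x]) auto
    qed
    show "?B \<subseteq> ?A"
    proof
      fix w assume "w \<in> ?B"
      then obtain x where x: "x \<in> beta (length la) la" "x mod e = r" "w = int x - ?L" by auto
      have "int x mod int e = int r mod int e" using x(2) assms by (metis mod_less zmod_int)
      then have "w mod int e = (int r - ?L) mod int e" unfolding x(3) by (rule mod_diff_cong) simp
      moreover have "r \<le> x" using x(2) by auto
      ultimately show "w \<in> ?A" using x by (simp add: mem_beta_iff)
    qed
  qed
  then show ?thesis by (simp add: runner_count_def card_image inj_on_def)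
qed

text \<open>Among the e positions starting at \<open>z\<close> only \<open>z\<close> itself is on
  its runner. This possible extra bead pays for the change of row when a step by -2 wraps around the
  abacus.\<close>

lemma runner_count_le:
  assumes "is_partition la" "0 < e"
  shows "runner_count e (maya la) z \<le> runner_count e (maya la) (z + int e) + 1"
proof -
  let ?A = "{w \<in> maya la. z + int e \<le> w \<and> w mod int e = (z + int e) mod int e}"
  have fin: "finite ?A" by (rule finite_subset[OF _ finite_maya_ge[OF assms(1), of "z + int e"]]) auto
  have "{w \<in> maya la. z \<le> w \<and> w mod int e = z mod int e} \<subseteq> insert z ?A"
  proof
    fix w assume w: "w \<in> {w \<in> maya la. z \<le> w \<and> w mod int e = z mod int e}"
    then have "int e dvd w - z" by (simp add: mod_eq_dvd_iff)
    then have "w = z \<or> int e \<le> w - z" using w zdvd_imp_le[of "int e" "w - z"] by fastforce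
    then show "w \<in> insert z ?A" using w by auto
  qed
  then have "runner_count e (maya la) z \<le> card (insert z ?A)"
    unfolding runner_count_def using fin by (intro card_mono) auto
  also have "\<dots> \<le> card ?A + 1" using fin by (simp add: card_insert_if)
  finally show ?thesis by (simp add: runner_count_def)
qed

text \<open>On runner \<open>r\<close> the core occupies the rows 0 to \<open>N r - 1\<close>. A
  step by -2 stays in its row if \<open>r \<ge> 2\<close>; for \<open>r < 2\<close> it lands on
  runner \<open>r + e - 2\<close> in the preceding row. \<open>N1\<close> and \<open>N2\<close> are
  the comparisons that keep these two kinds of steps inside.\<close>

lemma is_core_2_core:
  assumes la: "is_partition la" and e: "2 < e"
    and mono: "\<And>z. runner_count e (maya la) z \<le> runner_count e (maya la) (z - 2)"
  shows "is_core 2 (core e la)"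
proof -
  define N where "N r = card {x \<in> beta (length la) la. x mod e = r}" for r
  define C where "C = {r + e * m | r m. r < e \<and> m < N r}"
  have C_iff: "x \<in> C \<longleftrightarrow> x div e < N (x mod e)" for x
  proof
    assume "x \<in> C"
    then show "x div e < N (x mod e)" using e by (auto simp: C_def)
  next
    assume "x div e < N (x mod e)"
    moreover have "x = x mod e + e * (x div e)" by simp
    moreover have "x mod e < e" using e by simp
    ultimately show "x \<in> C" unfolding C_def by blast
  qed
  have "C = (\<Union>r<e. (\<lambda>m. r + e * m) ` {..<N r})" by (auto simp: C_def)
  then have fin: "finite C" by simp
  have N: "N r = runner_count e (maya la) (int r - int (length la))" if "r < e" for r
    using runner_count_beta[OF that] by (simp add: N_def)
  have N1: "N r \<le> N (r - 2)" if "2 \<le> r" "r < e" for r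
    using mono[of "int r - int (length la)"] that by (simp add: N algebra_simps)
  have N2: "N r \<le> N (r + e - 2) + 1" if "r < 2" for r
  proof -
    have "N r \<le> runner_count e (maya la) (int r - int (length la) - 2)"
      using mono[of "int r - int (length la)"] that e by (simp add: N)
    also have "\<dots> \<le> runner_count e (maya la) (int r - int (length la) - 2 + int e) + 1"
      using runner_count_le[OF la] e by simp
    also have "\<dots> = N (r + e - 2) + 1"
      using N[of "r + e - 2"] that e by (simp add: algebra_simps)
    finally show ?thesis .
  qed
  have "is_core 2 (part_of_beta C)"
  proof (rule is_core_2_part_of_beta[OF fin])
    fix x assume x: "x \<in> C" "2 \<le> x"
    define r m where "r = x mod e" and "m = x div e"
    have xe: "x = r + e * m" "r < e" "m < N r" using x(1) e by (auto simp: C_iff r_def m_def)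
    show "x - 2 \<in> C"
    proof (cases "2 \<le> r")
      case True
      then have "x - 2 = (r - 2) + e * m" using xe by simp
      moreover have "m < N (r - 2)" using N1[OF True xe(2)] xe(3) by simp
      ultimately show ?thesis using xe(2) unfolding C_def by fastforce
    next
      case False
      then obtain n where n: "m = Suc n" using x(2) xe by (cases m) auto
      have "x - 2 = (r + e - 2) + e * n" using xe(1) n e by simp
      moreover have "n < N (r + e - 2)" using N2[of r] False xe(3) n by simp
      moreover have "r + e - 2 < e" using False e by simp
      ultimately show ?thesis unfolding C_def by blast
    qed
  qed
  then show ?thesis by (simp add: core_def C_def N_def Let_def)
qed

section \<open>Two-quotients\<close>

text \<open>The integer that labels the 2-core: it is odd because the beta-set has odd size, and odd
  integers correspond bijectively to staircases.\<close>

definition charge :: "nat list \<Rightarrow> int" where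
  "charge la = int (card {x \<in> odd_beta la. even x}) - int (card {x \<in> odd_beta la. odd x})"

lemma fill_even: "2 * v \<in> fill X \<longleftrightarrow> v \<in> fill {y. 2 * y \<in> X}"
  by (simp add: fill_def nat_mult_distrib)

lemma fill_odd: "2 * v + 1 \<in> fill X \<longleftrightarrow> v \<in> fill {y. 2 * y + 1 \<in> X}"
proof (cases "v < 0")
  case True
  then show ?thesis by (simp add: fill_def)
next
  case False
  then have "nat (2 * v + 1) = 2 * nat v + 1" by simp
  then show ?thesis using False by (simp add: fill_def)
qed

lemma fill_half_even:
  assumes "length la \<le> n"
  shows "y \<in> fill {x div 2 | x. x \<in> beta n la \<and> even x} \<longleftrightarrow> 2 * y - int n \<in> maya la"
proof -
  have "{x div 2 | x. x \<in> beta n la \<and> even x} = {y. 2 * y \<in> beta n la}" by force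
  then show ?thesis
    using fill_beta[OF assms, of "2 * y - int n"] fill_even[of y "beta n la"] by simp
qed

lemma fill_half_odd:
  assumes "length la \<le> n"
  shows "y \<in> fill {(x - 1) div 2 | x. x \<in> beta n la \<and> odd x} \<longleftrightarrow> 2 * y + 1 - int n \<in> maya la"
proof -
  have "{(x - 1) div 2 | x. x \<in> beta n la \<and> odd x} = {y. 2 * y + 1 \<in> beta n la}" (is "?A = ?B")
  proof
    show "?B \<subseteq> ?A" by (auto intro!: exI[of _ "2 * y + 1" for y])
  qed (auto elim!: oddE)
  then show ?thesis
    using fill_beta[OF assms, of "2 * y + 1 - int n"] fill_odd[of y "beta n la"] by simp
qed

lemma odd_beta_eq_beta:
  obtains n where "odd_beta la = beta n la" "odd n" "length la \<le> n"
  using that[of "if odd (length la) then length la else length la + 1"] by (auto simp: odd_beta_def)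

lemma card_even_odd:
  assumes "is_partition la"
  shows "card {x \<in> beta n la. even x} + card {x \<in> beta n la. odd x} = n"
proof -
  have "{x \<in> beta n la. even x} \<union> {x \<in> beta n la. odd x} = beta n la" by blast
  moreover have "{x \<in> beta n la. even x} \<inter> {x \<in> beta n la. odd x} = {}" by blast
  ultimately show ?thesis
    using card_Un_disjoint[of "{x \<in> beta n la. even x}" "{x \<in> beta n la. odd x}"]
      card_beta[OF assms, of n] by simp
qed

text \<open>With \<open>a\<close> even and \<open>b\<close> odd beads, the bead 2y lies at 2y - (a +
  b) in the diagram of \<open>la\<close>, while y lies at w = y - a in that of its component; this
  gives 2w + a - b. For a bead 2y + 1 the roles of \<open>a\<close> and \<open>b\<close> are
  exchanged.\<close>

lemma
  assumes "is_partition la"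
  shows odd_charge: "odd (charge la)"
    and is_partition_quot2: "is_partition (fst (quot2 la))" "is_partition (snd (quot2 la))"
    and maya_fst_quot2: "w \<in> maya (fst (quot2 la)) \<longleftrightarrow> 2 * w + charge la \<in> maya la"
    and maya_snd_quot2: "w \<in> maya (snd (quot2 la)) \<longleftrightarrow> 2 * w + 1 - charge la \<in> maya la"
proof -
  obtain n where n: "odd_beta la = beta n la" "odd n" "length la \<le> n" by (rule odd_beta_eq_beta)
  define a b where "a = card {x \<in> beta n la. even x}" and "b = card {x \<in> beta n la. odd x}"
  have ab: "a + b = n" using card_even_odd[OF assms] by (simp add: a_def b_def)
  have charge: "charge la = int a - int b" by (simp add: charge_def n(1) a_def b_def)
  show "odd (charge la)" using ab n(2) unfolding charge by auto
  let ?E = "{x div 2 | x. x \<in> beta n la \<and> even x}"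
  let ?D = "{(x - 1) div 2 | x. x \<in> beta n la \<and> odd x}"
  have E: "?E = (\<lambda>x. x div 2) ` {x \<in> beta n la. even x}" by auto
  have D: "?D = (\<lambda>x. (x - 1) div 2) ` {x \<in> beta n la. odd x}" by auto
  have fin: "finite ?E" "finite ?D" unfolding E D by auto
  have cE: "card ?E = a" unfolding E a_def by (rule card_image) (auto simp: inj_on_def elim!: evenE)
  have cD: "card ?D = b" unfolding D b_def by (rule card_image) (auto simp: inj_on_def elim!: oddE)
  have q: "quot2 la = (part_of_beta ?E, part_of_beta ?D)" by (simp add: quot2_def n(1))
  show "is_partition (fst (quot2 la))" "is_partition (snd (quot2 la))"
    using fin by (simp_all add: q is_partition_part_of_beta)
  have *: "2 * (w + int a) - int n = 2 * w + charge la" using ab charge by simp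
  show "w \<in> maya (fst (quot2 la)) \<longleftrightarrow> 2 * w + charge la \<in> maya la"
    using maya_part_of_beta[OF fin(1), of w] fill_half_even[OF n(3), of "w + int a"]
    unfolding q cE * by (simp only: fst_conv)
  have *: "2 * (w + int b) + 1 - int n = 2 * w + 1 - charge la" using ab charge by simp
  show "w \<in> maya (snd (quot2 la)) \<longleftrightarrow> 2 * w + 1 - charge la \<in> maya la"
    using maya_part_of_beta[OF fin(2), of w] fill_half_odd[OF n(3), of "w + int b"]
    unfolding q cD * by (simp only: snd_conv)
qed

section \<open>Bead diagrams of 2-cores\<close>

lemma beta_Suc:
  assumes "length la \<le> n"
  shows "beta (Suc n) la = insert 0 (Suc ` beta n la)"
proof -
  have "{1..Suc n} = insert (Suc n) {1..n}" by auto
  moreover have "part la (Suc n) = 0" using assms by (simp add: part_def)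
  ultimately show ?thesis by (auto simp: beta_eq_image image_image Suc_diff_le intro!: image_cong)
qed

text \<open>Both runners are solid, with lowest vacancies \<open>d\<close> and \<open>1 - d\<close>.
  That these sum to 1 expresses that the diagram is an unshifted one.\<close>

definition two_core_maya :: "int \<Rightarrow> int set" where
  "two_core_maya d = {z. even (z - d) \<and> z < d \<or> odd (z - d) \<and> z < 1 - d}"

lemma two_core_maya_symm: "two_core_maya (1 - d) = two_core_maya d"
  by (auto simp: two_core_maya_def)

text \<open>The largest bead is \<open>max d (1 - d) - 2\<close>, and this maximum determines
  \<open>d\<close> up to exchange with \<open>1 - d\<close>.\<close>

lemma two_core_maya_inj:
  assumes "two_core_maya c = two_core_maya d"
  shows "d = c \<or> d = 1 - c"
proof -
  have le: "max c (1 - c) \<le> max d (1 - d)" if "two_core_maya c = two_core_maya d" for c d :: int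
  proof -
    have "max c (1 - c) - 2 \<in> two_core_maya c" by (auto simp: two_core_maya_def max_def)
    then have "max c (1 - c) - 2 \<in> two_core_maya d" using that by simp
    moreover have "z \<le> max d (1 - d) - 2" if "z \<in> two_core_maya d" for z
    proof -
      have "z \<noteq> d - 1" if "even (z - d)" using that by auto
      moreover have "z \<noteq> - d" if "odd (z - d)" using that by auto
      ultimately show ?thesis using that unfolding two_core_maya_def mem_Collect_eq by linarith
    qed
    ultimately show ?thesis by fastforce
  qed
  show ?thesis using le[OF assms] le[OF assms[symmetric]] by linarith
qed

lemma
  assumes "is_partition la"
  shows is_partition_core_2: "is_partition (core 2 la)"
    and maya_core_2: "maya (core 2 la) = two_core_maya (charge la)"
proof -
  let ?L = "length la"
  let ?B = "beta ?L la"
  define a b where "a = card {x \<in> ?B. even x}" and "b = card {x \<in> ?B. odd x}"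
  let ?K = "(\<lambda>m. 2 * m) ` {..<a} \<union> (\<lambda>m. Suc (2 * m)) ` {..<b}"
  have "{r + 2 * m | r m. r < 2 \<and> m < card {x \<in> ?B. x mod 2 = r}} = ?K"
  proof -
    have "{r + 2 * m | r m. r < 2 \<and> m < card {x \<in> ?B. x mod 2 = r}}
        = (\<Union>r<2. (\<lambda>m. r + 2 * m) ` {..<card {x \<in> ?B. x mod 2 = r}})" by auto
    also have "{..<2::nat} = {0, 1}" by auto
    finally show ?thesis by (simp add: a_def b_def even_iff_mod_2_eq_zero odd_iff_mod_2_eq_one)
  qed
  then have core: "core 2 la = part_of_beta ?K" by (simp add: core_def)
  have cK: "card ?K = a + b"
    by (subst card_Un_disjoint) (auto simp: card_image inj_on_def, presburger)
  have K_iff: "x \<in> ?K \<longleftrightarrow> even x \<and> x < 2 * a \<or> odd x \<and> x < 2 * b" for x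
  proof -
    have "x \<in> ?K \<longleftrightarrow> (\<exists>m<a. x = 2 * m) \<or> (\<exists>m<b. x = Suc (2 * m))" by auto
    also have "\<dots> \<longleftrightarrow> even x \<and> x < 2 * a \<or> odd x \<and> x < 2 * b" by presburger
    finally show ?thesis .
  qed
  show "is_partition (core 2 la)" unfolding core by (rule is_partition_part_of_beta) auto
  have "maya (core 2 la) = two_core_maya (int a - int b)"
  proof (rule set_eqI)
    fix z
    have "z \<in> maya (core 2 la) \<longleftrightarrow> z + int (a + b) \<in> fill ?K"
      unfolding core by (subst maya_part_of_beta) (simp_all only: cK finite_UnI finite_imageI finite_lessThan)
    also have "\<dots> \<longleftrightarrow> z \<in> two_core_maya (int a - int b)"
    proof (cases "z + int (a + b) < 0")
      case True
      then have "z < int a - int b" "z < 1 - (int a - int b)" by simp_all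
      then show ?thesis using True by (simp only: fill_def two_core_maya_def mem_Collect_eq) blast
    next
      case False
      define p where "p = nat (z + int (a + b))"
      have p: "int p = z - (int a - int b) + 2 * int a" using False by (simp add: p_def)
      have even: "even p \<longleftrightarrow> even (z - (int a - int b))"
        unfolding even_of_nat[of p, where 'a = int, symmetric] p by presburger
      have "z + int (a + b) \<in> fill ?K \<longleftrightarrow> even p \<and> p < 2 * a \<or> odd p \<and> p < 2 * b"
        using False unfolding fill_def mem_Collect_eq K_iff p_def by blast
      also have "\<dots> \<longleftrightarrow> z \<in> two_core_maya (int a - int b)"
      proof -
        have "p < 2 * a \<longleftrightarrow> z < int a - int b" "p < 2 * b \<longleftrightarrow> z < int b - int a"
          using p by linarith+
        moreover have "z < int b - int a \<longleftrightarrow> z < 1 - (int a - int b)" if "odd (z - (int a - int b))"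
        proof -
          have "z \<noteq> int b - int a" using that by auto
          then show ?thesis by linarith
        qed
        ultimately show ?thesis unfolding two_core_maya_def mem_Collect_eq even by blast
      qed
      finally show ?thesis .
    qed
    finally show "z \<in> maya (core 2 la) \<longleftrightarrow> z \<in> two_core_maya (int a - int b)" .
  qed
  \<comment> \<open>If \<open>length la\<close> is even, \<open>charge\<close> uses one bead more
    than \<open>core\<close>. The extra bead exchanges the parities and is itself the even bead 0,
    which turns \<open>d\<close> into \<open>1 - d\<close> and leaves the diagram unchanged.\<close>
  also have "\<dots> = two_core_maya (charge la)"
  proof (cases "odd ?L")
    case True
    then show ?thesis by (simp add: charge_def odd_beta_def a_def b_def)
  next
    case False
    then have ob: "odd_beta la = insert 0 (Suc ` ?B)" by (simp add: odd_beta_def beta_Suc)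
    have "{x \<in> odd_beta la. even x} = insert 0 (Suc ` {x \<in> ?B. odd x})"
      "{x \<in> odd_beta la. odd x} = Suc ` {x \<in> ?B. even x}" unfolding ob by auto
    then have "charge la = 1 - (int a - int b)"
      by (simp add: charge_def card_image a_def b_def)
    then show ?thesis by (simp add: two_core_maya_symm)
  qed
  finally show "maya (core 2 la) = two_core_maya (charge la)" .
qed

lemma part_staircase: "1 \<le> a \<Longrightarrow> part (staircase t) a = t + 1 - a"
  by (auto simp: part_def staircase_def rev_nth simp del: upt_Suc)

lemma is_partition_staircase: "is_partition (staircase t)"
  by (auto simp: is_partition_def staircase_def sorted_wrt_rev simp del: upt_Suc)

lemma maya_staircase: "maya (staircase t) = two_core_maya (int t + 1)"
proof (rule set_eqI)
  fix z
  show "z \<in> maya (staircase t) \<longleftrightarrow> z \<in> two_core_maya (int t + 1)"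
  proof
    assume "z \<in> maya (staircase t)"
    then obtain a where a: "1 \<le> a" "z = int (t + 1 - a) - int a" by (auto simp: maya_def part_staircase)
    show "z \<in> two_core_maya (int t + 1)"
    proof (cases "a \<le> t")
      case True
      then have "z = int t + 1 - 2 * int a" using a by simp
      then show ?thesis using a(1) by (simp add: two_core_maya_def)
    next
      case False
      then show ?thesis using a by (auto simp: two_core_maya_def)
    qed
  next
    assume z: "z \<in> two_core_maya (int t + 1)"
    show "z \<in> maya (staircase t)"
    proof (cases "z < - int t")
      case True
      then show ?thesis using mayaI[of "nat (-z)" "staircase t"] by (simp add: part_staircase)
    next
      case False
      then have "even (z - (int t + 1))" and zt: "z < int t + 1"
        using z by (auto simp: two_core_maya_def)
      then obtain j where j: "z - (int t + 1) = 2 * j" by (elim evenE)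
      define k where "k = - j"
      have k: "z = int t + 1 - 2 * k" "0 < k" "k \<le> int t"
        using j zt False by (auto simp: k_def)
      then have "z = int (part (staircase t) (nat k)) - int (nat k)" "1 \<le> nat k"
        by (simp_all add: part_staircase nat_diff_distrib)
      then show ?thesis using mayaI[of "nat k" "staircase t"] by (simp only:)
    qed
  qed
qed

text \<open>Both \<open>t + 1\<close> and \<open>-t\<close> label the same staircase, but only one
  of them is odd; which one depends on the parity of \<open>t\<close>, hence the swap in
  \<open>barquot2\<close>.\<close>

lemma core_2_eq_staircase_iff:
  assumes "is_partition la"
  shows "core 2 la = staircase t \<longleftrightarrow> charge la = (if even t then int t + 1 else - int t)"
proof -
  have "core 2 la = staircase t \<longleftrightarrow> two_core_maya (charge la) = two_core_maya (int t + 1)"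
    using maya_inj[OF is_partition_core_2[OF assms] is_partition_staircase] maya_core_2[OF assms] maya_staircase
    by metis
  also have "\<dots> \<longleftrightarrow> charge la = int t + 1 \<or> charge la = - int t"
  proof
    assume "two_core_maya (charge la) = two_core_maya (int t + 1)"
    from two_core_maya_inj[OF this[symmetric]] show "charge la = int t + 1 \<or> charge la = - int t" by simp
  next
    have "two_core_maya (- int t) = two_core_maya (int t + 1)"
      using two_core_maya_symm[of "int t + 1"] by simp
    then show "charge la = int t + 1 \<or> charge la = - int t \<Longrightarrow>
      two_core_maya (charge la) = two_core_maya (int t + 1)" by (elim disjE) simp_all
  qed
  also have "\<dots> \<longleftrightarrow> charge la = (if even t then int t + 1 else - int t)"
    using odd_charge[OF assms] by (cases "even t") (simp_all, presburger+)
  finally show ?thesis .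
qed

text \<open>The bead positions of the partition with 2-core \<open>(t, \<dots>, 1)\<close> and quotient \<open>mu\<close>;
  swapping the quotient for odd \<open>t\<close> makes the formula independent of the parity.\<close>
definition interleave :: "nat \<Rightarrow> bipartition \<Rightarrow> int set" where
  "interleave t mu = {2 * w + int t + 1 | w. w \<in> maya (fst mu)} \<union> {2 * w - int t | w. w \<in> maya (snd mu)}"

lemma interleave_fst: "2 * w + int t + 1 \<in> interleave t mu \<longleftrightarrow> w \<in> maya (fst mu)"
  unfolding interleave_def by (auto, presburger)

lemma interleave_snd: "2 * w - int t \<in> interleave t mu \<longleftrightarrow> w \<in> maya (snd mu)"
  unfolding interleave_def by (auto, presburger)

lemma int_parity_cases:
  obtains w where "(z::int) = 2 * w + int t + 1" | w where "z = 2 * w - int t"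
proof (cases "even (z + int t)")
  case True
  then obtain w where "z + int t = 2 * w" by (rule evenE)
  then show ?thesis using that(2)[of w] by simp
next
  case False
  then obtain w where "z + int t = 2 * w + 1" by (rule oddE)
  then show ?thesis using that(1)[of "w - int t"] by simp
qed

lemma exists_maya_interleave:
  assumes "is_bipartition mu"
  shows "\<exists>la. is_partition la \<and> maya la = interleave t mu"
proof -
  have mu: "is_partition (fst mu)" "is_partition (snd mu)" using assms by (auto simp: is_bipartition_def)
  define m where "m = max (length (fst mu)) (length (snd mu))"
  \<comment> \<open>The even beads outnumber the odd ones by t + 1, the charge wanted here;
    \<open>m\<close> covers all rows of both components.\<close>
  define A B where "A = beta (m + t + 1) (fst mu)" and "B = beta m (snd mu)"
  define X where "X = (\<lambda>y. 2 * y) ` A \<union> (\<lambda>y. 2 * y + 1) ` B"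
  have fin: "finite X" by (simp add: X_def A_def B_def)
  have "card A = m + t + 1" "card B = m" using card_beta mu by (simp_all add: A_def B_def)
  moreover have "card X = card A + card B" unfolding X_def
    by (subst card_Un_disjoint) (auto simp: card_image inj_on_def A_def B_def, presburger)
  ultimately have cX: "card X = 2 * m + t + 1" by simp
  have X: "{y. 2 * y \<in> X} = A" "{y. 2 * y + 1 \<in> X} = B"
    unfolding X_def by (auto, presburger+)
  have "z \<in> maya (part_of_beta X) \<longleftrightarrow> z \<in> interleave t mu" for z
  proof (cases z rule: int_parity_cases[where t = t])
    case (1 w)
    have "z + int (card X) = 2 * (w + int (m + t + 1))" unfolding cX 1 by simp
    then have "z \<in> maya (part_of_beta X) \<longleftrightarrow> w + int (m + t + 1) \<in> fill A"
      unfolding maya_part_of_beta[OF fin] by (simp only: fill_even X)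
    also have "\<dots> \<longleftrightarrow> w \<in> maya (fst mu)" unfolding A_def by (rule fill_beta) (simp add: m_def)
    finally show ?thesis by (simp only: 1 interleave_fst)
  next
    case (2 w)
    have "z + int (card X) = 2 * (w + int m) + 1" unfolding cX 2 by simp
    then have "z \<in> maya (part_of_beta X) \<longleftrightarrow> w + int m \<in> fill B"
      unfolding maya_part_of_beta[OF fin] by (simp only: fill_odd X)
    also have "\<dots> \<longleftrightarrow> w \<in> maya (snd mu)" unfolding B_def by (rule fill_beta) (simp add: m_def)
    finally show ?thesis by (simp only: 2 interleave_snd)
  qed
  then show ?thesis using is_partition_part_of_beta[OF fin] by blast
qed

text \<open>\<open>Phi\<close> is a definite description, so existence and uniqueness are both due.
  Both follow once the describing conditions are shown equivalent to having the diagram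
  \<open>interleave t mu\<close>.\<close>

lemma Phi_maya:
  assumes "is_bipartition mu"
  shows "is_partition (Phi t mu)" "maya (Phi t mu) = interleave t mu"
proof -
  have mu: "is_partition (fst mu)" "is_partition (snd mu)" using assms by (auto simp: is_bipartition_def)
  define P where "P la \<longleftrightarrow> is_partition la \<and> core 2 la = staircase t \<and> barquot2 t la = mu" for la
  have P_imp: "maya la = interleave t mu" if "P la" for la
  proof (rule set_eqI)
    fix z
    have la: "is_partition la" and bar: "barquot2 t la = mu" using that by (auto simp: P_def)
    have charge: "charge la = (if even t then int t + 1 else - int t)"
      using that core_2_eq_staircase_iff[OF la, of t] by (simp add: P_def)
    have "w \<in> maya (fst mu) \<longleftrightarrow> 2 * w + int t + 1 \<in> maya la"
      "w \<in> maya (snd mu) \<longleftrightarrow> 2 * w - int t \<in> maya la" for w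
      using maya_fst_quot2[OF la, of w] maya_snd_quot2[OF la, of w]
      by (cases "even t"; simp add: charge barquot2_def algebra_simps flip: bar)+
    then show "z \<in> maya la \<longleftrightarrow> z \<in> interleave t mu"
      by (cases z rule: int_parity_cases[where t = t]) (simp_all add: interleave_fst interleave_snd)
  qed
  have P_if: "P la" if la: "is_partition la" and maya: "maya la = interleave t mu" for la
  proof -
    note q = is_partition_quot2[OF la]
    \<comment> \<open>Parity leaves an unknown deviation 2k. It would shift a quotient component
      against a component of \<open>mu\<close>, and diagrams of two partitions never differ by a
      nonzero shift.\<close>
    have charge: "charge la = (if even t then int t + 1 else - int t)"
    proof (cases "even t")
      case True
      then obtain k where k: "charge la = int t + 1 + 2 * k" using odd_charge[OF la]
        by (metis add_diff_cancel_left' diff_add_cancel even_add evenE even_of_nat odd_one)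
      have "w \<in> maya (fst (quot2 la)) \<longleftrightarrow> w + k \<in> maya (fst mu)" for w
        using maya_fst_quot2[OF la, of w] interleave_fst[of "w + k" t mu] unfolding maya k
        by (simp add: algebra_simps)
      then have "k = 0" by (rule maya_shift_zero[OF q(1) mu(1)])
      then show ?thesis using k True by simp
    next
      case False
      then obtain k where k: "charge la = 2 * k - int t" using odd_charge[OF la]
        by (metis add_diff_cancel_right' even_add evenE even_of_nat)
      have "w \<in> maya (fst (quot2 la)) \<longleftrightarrow> w + k \<in> maya (snd mu)" for w
        using maya_fst_quot2[OF la, of w] interleave_snd[of "w + k" t mu] unfolding maya k
        by (simp add: algebra_simps)
      then have "k = 0" by (rule maya_shift_zero[OF q(1) mu(2)])
      then show ?thesis using k False by simp
    qed
    have *: "w \<in> maya (fst (barquot2 t la)) \<longleftrightarrow> w \<in> maya (fst mu)"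
      "w \<in> maya (snd (barquot2 t la)) \<longleftrightarrow> w \<in> maya (snd mu)" for w
      using maya_fst_quot2[OF la, of w] maya_snd_quot2[OF la, of w]
        interleave_fst[of w t mu] interleave_snd[of w t mu]
      by (cases "even t"; simp add: charge barquot2_def maya algebra_simps)+
    have "is_partition (fst (barquot2 t la))" "is_partition (snd (barquot2 t la))"
      using q by (simp_all add: barquot2_def)
    then have "barquot2 t la = mu"
      using * mu by (intro prod_eqI maya_inj) auto
    then show ?thesis using la charge core_2_eq_staircase_iff[OF la] by (simp add: P_def)
  qed
  obtain la where la: "is_partition la" "maya la = interleave t mu"
    using exists_maya_interleave[OF assms] by blast
  have "Phi t mu = la" unfolding Phi_def
  proof (rule the_equality)
    show "is_partition la \<and> core 2 la = staircase t \<and> barquot2 t la = mu"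
      using P_if[OF la] by (simp add: P_def)
    show "lb = la" if "is_partition lb \<and> core 2 lb = staircase t \<and> barquot2 t lb = mu" for lb
      using maya_inj[of lb la] P_imp[of lb] that la by (simp add: P_def)
  qed
  then show "is_partition (Phi t mu)" "maya (Phi t mu) = interleave t mu" using la by auto
qed

section \<open>Signatures\<close>

text \<open>The stack is the reversed output, so cancellation can be resumed from it.\<close>

lemma cancel_RA_append:
  "cancel_RA st (u @ v) = cancel_RA (rev (cancel_RA st u)) v"
  by (induction st u rule: cancel_RA.induct) auto

definition excess :: "(bool \<times> 'a) list \<Rightarrow> int" where
  "excess w = (\<Sum>x\<leftarrow>w. if fst x then - 1 else 1)"

lemma excess_simps [simp]:
  "excess [] = 0" "excess (x # w) = (if fst x then - 1 else 1) + excess w"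
  "excess (u @ v) = excess u + excess v"
  by (simp_all add: excess_def)

text \<open>The number of surviving R's is governed by the largest excess of a final segment. A
  general \<open>k\<close> lets the induction from the right close: dropping a last A permits
  \<open>k + 1\<close>, dropping a last R leaves \<open>k - 1\<close>. For \<open>k = 0\<close> no R
  survives.\<close>

lemma cancel_RA_suffix_bound:
  assumes "\<forall>u1 u2. u = u1 @ u2 \<longrightarrow> excess u2 \<le> k"
  shows "\<exists>as rs. cancel_RA [] u = as @ rs \<and> (\<forall>x\<in>set as. fst x) \<and> (\<forall>x\<in>set rs. \<not> fst x) \<and> int (length rs) \<le> k"
  using assms
proof (induction u arbitrary: k rule: rev_induct)
  case Nil
  then have "0 \<le> k" by force
  then show ?case by auto
next
  case (snoc x u)
  obtain b y where x: "x = (b, y)" by (cases x)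
  have k: "0 \<le> k" using snoc.prems[rule_format, of "u @ [x]" "[]"] by simp
  show ?case
  proof (cases b)
    case True
    have "\<forall>u1 u2. u = u1 @ u2 \<longrightarrow> excess u2 \<le> k + 1"
    proof (intro allI impI)
      fix u1 u2 assume "u = u1 @ u2"
      then show "excess u2 \<le> k + 1" using snoc.prems[rule_format, of u1 "u2 @ [x]"] x True by simp
    qed
    from snoc.IH[OF this] obtain as rs where
      IH: "cancel_RA [] u = as @ rs" "\<forall>x\<in>set as. fst x" "\<forall>x\<in>set rs. \<not> fst x" "int (length rs) \<le> k + 1"
      by blast
    show ?thesis
    proof (cases rs rule: rev_cases)
      case Nil
      have "cancel_RA [] (u @ [x]) = as @ [x]"
        using IH Nil x True by (cases as rule: rev_cases) (auto simp: cancel_RA_append)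
      then show ?thesis using IH k x True
        by (intro exI[of _ "as @ [x]"] exI[of _ "[]"]) auto
    next
      case (snoc rs' r)
      then have "cancel_RA [] (u @ [x]) = as @ rs'"
        using IH x True by (cases r) (auto simp: cancel_RA_append)
      then show ?thesis using IH snoc by (intro exI[of _ as] exI[of _ rs']) auto
    qed
  next
    case False
    have "\<forall>u1 u2. u = u1 @ u2 \<longrightarrow> excess u2 \<le> k - 1"
    proof (intro allI impI)
      fix u1 u2 assume "u = u1 @ u2"
      then show "excess u2 \<le> k - 1" using snoc.prems[rule_format, of u1 "u2 @ [x]"] x False by simp
    qed
    from snoc.IH[OF this] obtain as rs where
      IH: "cancel_RA [] u = as @ rs" "\<forall>x\<in>set as. fst x" "\<forall>x\<in>set rs. \<not> fst x" "int (length rs) \<le> k - 1"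
      by blast
    have "cancel_RA [] (u @ [x]) = as @ (rs @ [x])"
      using IH x False by (simp add: cancel_RA_append)
    then show ?thesis using IH x False
      by (intro exI[of _ as] exI[of _ "rs @ [x]"]) auto
  qed
qed

text \<open>The letters \<open>rs\<close> are R's waiting on top of the stack. Each A of
  \<open>v\<close> meets one of them or an earlier R of \<open>v\<close>, so \<open>st\<close> below
  is never touched.\<close>

lemma cancel_RA_prefix_nonneg:
  assumes "\<forall>v1 v2. v = v1 @ v2 \<longrightarrow> 0 \<le> excess v1 + int (length rs)" "\<forall>x\<in>set rs. \<not> fst x"
  shows "filter fst (cancel_RA (rs @ st) v) = filter fst (rev st)"
  using assms
proof (induction v arbitrary: rs)
  case Nil
  then show ?case by (auto simp: filter_empty_conv)
next
  case (Cons x v)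
  obtain b y where x: "x = (b, y)" by (cases x)
  show ?case
  proof (cases b)
    case True
    obtain r rs' where rs: "rs = r # rs'" using Cons.prems(1)[rule_format, of "[x]" v] x True by (cases rs) auto
    have *: "cancel_RA (rs @ st) (x # v) = cancel_RA (rs' @ st) v"
      using rs Cons.prems(2) x True by (cases r) auto
    have "\<forall>v1 v2. v = v1 @ v2 \<longrightarrow> 0 \<le> excess v1 + int (length (rs'))"
      using Cons.prems(1)[rule_format, of "x # v1" v2 for v1 v2] x True rs by force
    then show ?thesis unfolding * using Cons.IH[of rs'] Cons.prems(2) rs by simp
  next
    case False
    have *: "cancel_RA (rs @ st) (x # v) = cancel_RA ((x # rs) @ st) v"
      using x False by simp
    have "\<forall>v1 v2. v = v1 @ v2 \<longrightarrow> 0 \<le> excess v1 + int (length (x # rs))"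
      using Cons.prems(1)[rule_format, of "x # v1" v2 for v1 v2] x False by force
    then show ?thesis unfolding * using Cons.IH[of "x # rs"] Cons.prems(2) x False by simp
  qed
qed

text \<open>Turning the leftmost uncancelled letter R into an A makes it the rightmost uncancelled A;
  it is found at the last position where the excess of the remaining word is maximal.\<close>
lemma positive_excess_flip:
  fixes w :: "(bool \<times> 'a) list"
  assumes "w = w1 @ w2" "0 < excess w2"
  obtains u n v where "w = u @ (False, n) # v"
    "\<exists>as. filter fst (cancel_RA [] (u @ (True, n) # v)) = as @ [(True, n)]"
proof -
  define h where "h p = excess (drop p w)" for p
  define m where "m = Max (h ` {..length w})"
  define p where "p = Max {p \<in> {..length w}. h p = m}"
  have "m \<in> h ` {..length w}" unfolding m_def by (rule Max_in) auto
  then have "{p \<in> {..length w}. h p = m} \<noteq> {}" by auto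
  then have "p \<in> {p \<in> {..length w}. h p = m}" unfolding p_def by (intro Max_in) auto
  then have p: "p \<le> length w" "h p = m" by auto
  have le: "h q \<le> m" if "q \<le> length w" for q unfolding m_def using that by (intro Max_ge) auto
  have less: "h q < m" if "p < q" "q \<le> length w" for q
  proof (rule ccontr)
    assume "\<not> h q < m"
    then have "q \<in> {p \<in> {..length w}. h p = m}" using le that by force
    then have "q \<le> p" unfolding p_def by (intro Max_ge) auto
    then show False using that by simp
  qed
  have "0 < m" using le[of "length w1"] assms by (simp add: h_def)
  then have pl: "p < length w" using p by (cases "p = length w") (auto simp: h_def)
  define u v where "u = take p w" and "v = drop (Suc p) w"
  obtain b n where bn: "w ! p = (b, n)" by (cases "w ! p")
  have w: "w = u @ (b, n) # v" using id_take_nth_drop[OF pl] bn by (simp add: u_def v_def)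
  have u: "length u = p" using pl by (simp add: u_def)
  have hp: "m = (if b then - 1 else 1) + excess v" using p(2) u by (simp add: h_def w)
  have "excess v < m" using less[of "Suc p"] pl by (simp add: h_def v_def)
  then have b: "\<not> b" using hp by auto
  \<comment> \<open>By maximality of \<open>m\<close>, since the final segment of \<open>w\<close>
    beginning with \<open>u2\<close> has excess \<open>excess u2 + m\<close>. Hence no R of
    \<open>u\<close> survives to cancel the new A.\<close>
  have "\<forall>u1 u2. u = u1 @ u2 \<longrightarrow> excess u2 \<le> 0"
  proof (intro allI impI)
    fix u1 u2 assume "u = u1 @ u2"
    then show "excess u2 \<le> 0" using le[of "length u1"] hp b by (simp add: h_def w)
  qed
  from cancel_RA_suffix_bound[OF this] obtain as where
    as: "cancel_RA [] u = as" "\<forall>x\<in>set as. fst x" by auto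
  \<comment> \<open>As \<open>p\<close> is the last maximum, what follows \<open>v1\<close> has
    excess at most \<open>m - 1\<close>, which is \<open>excess v\<close>. Hence every A of
    \<open>v\<close> is cancelled within \<open>v\<close>, and the new A is the rightmost one
    left.\<close>
  have "\<forall>v1 v2. v = v1 @ v2 \<longrightarrow> 0 \<le> excess v1 + int (length ([] :: (bool \<times> 'a) list))"
  proof (intro allI impI)
    fix v1 v2 assume "v = v1 @ v2"
    then show "0 \<le> excess v1 + int (length ([] :: (bool \<times> 'a) list))"
      using less[of "p + 1 + length v1"] hp b u by (simp add: h_def w)
  qed
  from cancel_RA_prefix_nonneg[OF this, of "(True, n) # rev as"] have
    "filter fst (cancel_RA ((True, n) # rev as) v) = filter fst as @ [(True, n)]" by simp
  moreover have "cancel_RA (rev as) ((True, n) # v) = cancel_RA ((True, n) # rev as) v"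
    using as(2) by (cases as rule: rev_cases) auto
  ultimately have "filter fst (cancel_RA [] (u @ (True, n) # v)) = filter fst as @ [(True, n)]"
    by (simp add: cancel_RA_append as(1))
  then show ?thesis using that w b by blast
qed

section \<open>Corners of a partition as bead moves\<close>

lemma addable_iff:
  assumes "is_partition la"
  shows "(a, b) \<in> set (addable la) \<longleftrightarrow>
    1 \<le> a \<and> b = part la a + 1 \<and> (a = 1 \<or> part la a < part la (a - 1))"
proof -
  have "a \<le> length la + 1" if "a \<noteq> 1" "1 \<le> a" "part la a < part la (a - 1)"
  proof -
    have "1 \<le> a - 1" using that by linarith
    then show ?thesis using that(3) part_pos_iff[OF assms, of "a - 1"] by simp
  qed
  then show ?thesis by (cases "a = 1") (auto simp: addable_def image_iff simp del: upt_Suc)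
qed

lemma removable_iff:
  "(a, b) \<in> set (removable la) \<longleftrightarrow> 1 \<le> a \<and> b = part la a \<and> part la (a + 1) < part la a"
  by (auto simp: removable_def part_def simp del: upt_Suc)

lemma addable_maya:
  assumes la: "is_partition la" and ab: "(a, b) \<in> set (addable la)"
  shows "int b - int a - 1 \<in> maya la" "int b - int a \<notin> maya la"
proof -
  have *: "1 \<le> a" "b = part la a + 1" "a = 1 \<or> part la a < part la (a - 1)"
    using ab addable_iff[OF la] by auto
  show "int b - int a - 1 \<in> maya la" using mayaI[OF *(1), of la] *(2) by simp
  show "int b - int a \<notin> maya la"
  proof
    assume "int b - int a \<in> maya la"
    then obtain x where x: "1 \<le> x" "int b - int a = int (part la x) - int x" by (auto simp: maya_def)
    show False
    proof (cases "a \<le> x")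
      case True
      then show False using part_antimono[OF la *(1) True] x *(2) by simp
    next
      case False
      then have "part la (a - 1) \<le> part la x" using part_antimono[OF la x(1), of "a - 1"] by simp
      then show False using False x * by simp
    qed
  qed
qed

lemma removable_maya:
  assumes la: "is_partition la" and ab: "(a, b) \<in> set (removable la)"
  shows "int b - int a \<in> maya la" "int b - int a - 1 \<notin> maya la"
proof -
  have *: "1 \<le> a" "b = part la a" "part la (a + 1) < part la a"
    using ab by (auto simp: removable_iff)
  show "int b - int a \<in> maya la" using mayaI[OF *(1), of la] *(2) by simp
  show "int b - int a - 1 \<notin> maya la"
  proof
    assume "int b - int a - 1 \<in> maya la"
    then obtain x where x: "1 \<le> x" "int b - int a - 1 = int (part la x) - int x" by (auto simp: maya_def)
    show False
    proof (cases "x \<le> a")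
      case True
      then show False using part_antimono[OF la x(1) True] x *(2) by simp
    next
      case False
      then have "part la x \<le> part la (a + 1)" using part_antimono[OF la, of "a + 1" x] by simp
      then show False using False x * by simp
    qed
  qed
qed

lemma maya_removable:
  assumes la: "is_partition la" and "z \<in> maya la" "z - 1 \<notin> maya la"
  obtains a b where "(a, b) \<in> set (removable la)" "int b - int a = z"
proof -
  obtain a where a: "1 \<le> a" "z = int (part la a) - int a" using assms(2) by (auto simp: maya_def)
  have "part la (a + 1) \<noteq> part la a" using mayaI[of "a + 1" la] assms(3) a(2) by (auto simp: algebra_simps)
  then have "(a, part la a) \<in> set (removable la)"
    using part_antimono[OF la a(1), of "a + 1"] a(1) by (simp add: removable_iff)
  then show ?thesis using that a(2) by simp
qed

text \<open>At its content an addable corner has a vacancy and a removable one a bead, so the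
  content decides the kind; among corners of one kind it strictly decreases down the rows.\<close>

lemma corner_content_inj:
  assumes la: "is_partition la"
    and "(a, b) \<in> set ((if s then addable else removable) la)"
    and "(a', b') \<in> set ((if s' then addable else removable) la)"
    and eq: "int b - int a = int b' - int a'"
  shows "s = s' \<and> a = a' \<and> b = b'"
proof -
  have s: "s = s'"
    using assms addable_maya[OF la, of a b] addable_maya[OF la, of a' b']
      removable_maya[OF la, of a b] removable_maya[OF la, of a' b']
    by (auto split: if_splits)
  have "1 \<le> a" "1 \<le> a'" "int (part la a) - int a = int (part la a') - int a'"
    using assms s by (auto simp: addable_iff[OF la] removable_iff split: if_splits)
  then have "a = a'"
    using part_strict[OF la, of a a'] part_strict[OF la, of a' a] by (cases a a' rule: linorder_cases) auto
  then show ?thesis using s eq by simp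
qed

text \<open>Inverts \<open>add_box\<close>, with one case for each branch of its definition: a row
  of one box disappears, a longer row shrinks.\<close>

lemma removable_box:
  assumes la: "is_partition la" and ab: "(a, b) \<in> set (removable la)"
  obtains la' where "is_partition la'" "\<And>x. 1 \<le> x \<Longrightarrow> part la' x = part la x - (if x = a then 1 else 0)"
    "add_box la' a = la"
proof -
  have *: "1 \<le> a" "b = part la a" "part la (a + 1) < part la a"
    using ab by (auto simp: removable_iff)
  have len: "a \<le> length la" using part_pos_iff[OF la *(1)] * by simp
  have nth: "la ! (a - 1) = b" using * len by (simp add: part_def)
  show ?thesis
  proof (cases "b = 1")
    case True
    then have "a = length la" using part_pos_iff[OF la, of "a + 1"] * len by simp
    then obtain la' where la': "la = la' @ [1]" "a = length la' + 1"
      using nth True *(1) by (cases la rule: rev_cases) auto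
    show ?thesis
    proof (rule that)
      show "is_partition la'" using la by (auto simp: la' is_partition_def sorted_wrt_append)
      show "add_box la' a = la" by (simp add: add_box_def la')
      show "part la' x = part la x - (if x = a then 1 else 0)" if "1 \<le> x" for x
        using that by (auto simp: part_def la' nth_append)
    qed
  next
    case False
    then have b: "2 \<le> b" using * by simp
    let ?la' = "la[a - 1 := b - 1]"
    have part: "part ?la' x = part la x - (if x = a then 1 else 0)" if "1 \<le> x" for x
    proof (cases "x = a")
      case True
      then show ?thesis using * len by (simp add: part_def)
    next
      case False
      then have "a - 1 \<noteq> x - 1" using that *(1) by simp
      then show ?thesis using False by (simp add: part_def)
    qed
    show ?thesis
    proof (rule that)
      show "part ?la' x = part la x - (if x = a then 1 else 0)" if "1 \<le> x" for x by (rule part[OF that])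
      show "add_box ?la' a = la" using len * nth b by (simp add: add_box_def) (metis list_update_id)
      have le: "part ?la' (j + 1) \<le> part ?la' (i + 1)" if "i < j" for i j
      proof (cases "i + 1 = a")
        case True
        then have "part la (j + 1) \<le> part la (a + 1)" using part_antimono[OF la, of "a + 1" "j + 1"] that by simp
        then show ?thesis using part[of "i + 1"] part[of "j + 1"] True that * by simp
      next
        case False
        then show ?thesis using part[of "i + 1"] part[of "j + 1"] part_antimono[OF la, of "i + 1" "j + 1"] that
          by simp
      qed
      have "sorted_wrt (\<ge>) ?la'" unfolding sorted_wrt_iff_nth_less
      proof (intro allI impI)
        fix i j assume "i < j" "j < length ?la'"
        then show "?la' ! j \<le> ?la' ! i" using le[of i j] by (simp add: part_def)
      qed
      moreover have "0 \<notin> set ?la'"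
        using la b set_update_subset_insert[of la "a - 1" "b - 1"] by (auto simp: is_partition_def)
      ultimately show "is_partition ?la'" by (simp add: is_partition_def)
    qed
  qed
qed

text \<open>Apart from the box itself, its removal affects only corners whose content differs from
  that of the box by 1. These are what \<open>ne\<close> excludes.\<close>

lemma corner_remove:
  assumes la: "is_partition la" and la': "is_partition la'"
    and part: "\<And>x. 1 \<le> x \<Longrightarrow> part la' x = part la x - (if x = a then 1 else 0)"
    and ab: "(a, b) \<in> set (removable la)"
    and ne: "int y - int x \<noteq> int b - int a + 1" "int y - int x \<noteq> int b - int a - 1"
  shows "(x, y) \<in> set (addable la') \<longleftrightarrow> (x, y) \<in> set (addable la) \<or> (x, y) = (a, b)"
    and "(x, y) \<in> set (removable la') \<longleftrightarrow> (x, y) \<in> set (removable la) \<and> (x, y) \<noteq> (a, b)"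
proof -
  have *: "1 \<le> a" "b = part la a" "part la (a + 1) < part la a"
    using ab by (auto simp: removable_iff)
  have anti: "2 \<le> x \<Longrightarrow> part la x \<le> part la (x - 1)" using part_antimono[OF la, of "x - 1" x] by simp
  have anti': "1 \<le> x \<Longrightarrow> part la (x + 1) \<le> part la x" using part_antimono[OF la, of x "x + 1"] by simp
  show "(x, y) \<in> set (addable la') \<longleftrightarrow> (x, y) \<in> set (addable la) \<or> (x, y) = (a, b)"
  proof (cases "x = 0 \<or> x = a \<or> x = a + 1")
    case False
    then have "part la' x = part la x" "x = 1 \<or> part la' (x - 1) = part la (x - 1)"
      using part[of x] part[of "x - 1"] by (cases "x = 1"; auto)+
    then show ?thesis using False by (auto simp: addable_iff[OF la] addable_iff[OF la'])
  next
    case True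
    then consider "x = 0" | "x = a" | "x = a + 1" by blast
    then show ?thesis
    proof cases
      case 1
      then show ?thesis using *(1) by (simp add: addable_iff[OF la] addable_iff[OF la'])
    next
      case 2
      have "part la' a = b - 1" using part[OF *(1)] * by simp
      moreover have "a = 1 \<or> part la' a < part la' (a - 1)"
      proof (cases "a = 1")
        case False
        then have "part la' (a - 1) = part la (a - 1)" "b \<le> part la (a - 1)"
          using part[of "a - 1"] anti 2 * by auto
        moreover have "0 < b" using * by simp
        ultimately show ?thesis using \<open>part la' a = b - 1\<close> by linarith
      qed simp
      ultimately show ?thesis using 2 * ne by (auto simp: addable_iff[OF la] addable_iff[OF la'])
    next
      case 3
      then have "part la' x = part la x" "part la' a = b - 1" using part[of a] part[of "a + 1"] * by auto
      then show ?thesis using 3 * ne by (auto simp: addable_iff[OF la] addable_iff[OF la'])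
    qed
  qed
  show "(x, y) \<in> set (removable la') \<longleftrightarrow> (x, y) \<in> set (removable la) \<and> (x, y) \<noteq> (a, b)"
  proof (cases "x = 0 \<or> x = a \<or> x + 1 = a")
    case False
    then have "part la' x = part la x" "part la' (x + 1) = part la (x + 1)"
      using part[of x] part[of "x + 1"] by auto
    then show ?thesis using False by (auto simp: removable_iff)
  next
    case True
    then consider "x = 0" | "x = a" | "1 \<le> x" "x + 1 = a" by linarith
    then show ?thesis
    proof cases
      case 1
      then show ?thesis by (simp add: removable_iff)
    next
      case 2
      have "part la' a = b - 1" "part la' (a + 1) = part la (a + 1)"
        using part[of a] part[of "a + 1"] * by auto
      then show ?thesis using 2 * ne by (auto simp: removable_iff)
    next
      case 3
      then have p: "part la' x = part la x" "part la' (x + 1) = b - 1" "part la (x + 1) = b"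
        using part[of x] part[of a] * by auto
      then show ?thesis using 3 * ne anti' by (auto simp: removable_iff)
    qed
  qed
qed

section \<open>Signature words under removal of a node\<close>

definition key :: "int \<times> int \<Rightarrow> bool \<times> node \<Rightarrow> int" where
  "key c = (\<lambda>(_, n). 2 * content c n + (2 - int (snd (snd n))))"

lemma mem_nodes_of: "(a, b, k) \<in> set (nodes_of ns j) \<longleftrightarrow> k = j \<and> (a, b) \<in> set ns"
  by (auto simp: nodes_of_def)

lemma mem_sig_word:
  "(s, a, b, j) \<in> set (sig_word c e i mu) \<longleftrightarrow>
    (j = 1 \<or> j = 2) \<and> (a, b) \<in> set ((if s then addable else removable) (comp mu j)) \<and>
    residue e c (a, b, j) = int i"
  unfolding sig_word_def by (auto simp: mem_nodes_of)

lemma is_partition_comp: "is_bipartition mu \<Longrightarrow> is_partition (comp mu j)"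
  by (simp add: is_bipartition_def comp_def)

text \<open>The content is doubled and the tie-break term is 0 or 1, so the parity of the key
  reveals the component, and the content the corner. Without ties the word is determined by its set
  of letters.\<close>

lemma inj_on_key_sig_word:
  assumes "is_bipartition mu"
  shows "inj_on (key c) (set (sig_word c e i mu))"
proof (rule inj_onI)
  fix x x' assume mem: "x \<in> set (sig_word c e i mu)" "x' \<in> set (sig_word c e i mu)" and eq: "key c x = key c x'"
  obtain s a b j s' a' b' j' where x: "x = (s, a, b, j)" "x' = (s', a', b', j')"
    by (metis prod.exhaust)
  have j: "j = 1 \<or> j = 2" "j' = 1 \<or> j' = 2" using mem by (auto simp: x mem_sig_word)
  have jj: "j = j'" using eq j by (auto simp: x key_def; presburger)
  then have "int b - int a = int b' - int a'" using eq by (simp add: x key_def content_def)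
  then have "s = s' \<and> a = a' \<and> b = b'"
    using mem jj corner_content_inj[OF is_partition_comp[OF assms, of j], of a b s a' b' s']
    by (simp add: x mem_sig_word)
  then show "x = x'" using jj x by simp
qed

lemma distinct_sig_word: "distinct (sig_word c e i mu)"
  unfolding sig_word_def distinct_sort nodes_of_def addable_def removable_def
  by (rule distinct_filter) (auto simp: distinct_map inj_on_def simp del: upt_Suc)

lemma sorted_sig_word: "sorted (map (key c) (sig_word c e i mu))"
  unfolding sig_word_def key_def by (rule sorted_sort_key)

lemma sig_word_eqI:
  assumes "is_bipartition mu" "set xs = set (sig_word c e i mu)"
    "sorted (map (key c) xs)" "distinct (map (key c) xs)"
  shows "sig_word c e i mu = xs"
proof -
  have "map (key c) (sig_word c e i mu) = map (key c) xs"
    using assms inj_on_key_sig_word[OF assms(1), of c e i] sorted_sig_word distinct_sig_word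
    by (intro sorted_distinct_set_unique) (auto simp: distinct_map)
  then show ?thesis by (rule map_inj_on) (simp add: assms(2) inj_on_key_sig_word[OF assms(1)])
qed

text \<open>The removed box becomes addable, and all other letters of residue \<open>i\<close>
  persist. Since \<open>key\<close> ignores the kind of a letter, the flipped letter keeps its
  place.\<close>

lemma sig_word_remove:
  assumes "1 < e" and mu: "is_bipartition mu" and w: "sig_word c e i mu = u @ (False, n) # v"
  obtains nu where "is_bipartition nu" "add_node nu n = mu" "sig_word c e i nu = u @ (True, n) # v"
proof -
  obtain a b j where n: "n = (a, b, j)" by (cases n)
  have "(False, a, b, j) \<in> set (sig_word c e i mu)" using w n by simp
  then have j: "j = 1 \<or> j = 2" and ab: "(a, b) \<in> set (removable (comp mu j))" and res: "residue e c (a, b, j) = int i"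
    by (auto simp: mem_sig_word)
  note la = is_partition_comp[OF mu, of j]
  obtain la' where la': "is_partition la'" "\<And>x. 1 \<le> x \<Longrightarrow> part la' x = part (comp mu j) x - (if x = a then 1 else 0)"
    "add_box la' a = comp mu j"
    using removable_box[OF la ab] by blast
  define nu where "nu = (if j = 1 then (la', snd mu) else (fst mu, la'))"
  have nu: "is_bipartition nu" using mu la'(1) by (auto simp: nu_def is_bipartition_def)
  have add: "add_node nu n = mu"
    using la'(3) j by (auto simp: nu_def add_node_def n comp_def)
  have comp_nu: "comp nu j = la'" "j' = 1 \<or> j' = 2 \<Longrightarrow> j' \<noteq> j \<Longrightarrow> comp nu j' = comp mu j'" for j'
    using j by (auto simp: nu_def comp_def)
  have "(s, x, y, j') \<in> set (sig_word c e i nu) \<longleftrightarrow> (s, x, y, j') \<in> insert (True, n) (set (sig_word c e i mu) - {(False, n)})"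
    for s x y j'
  proof (cases "j' = j \<and> residue e c (x, y, j') = int i")
    case False
    then have "(x, y, j') \<noteq> n" using res n by auto
    moreover have "comp nu j' = comp mu j'"
      if "j' = 1 \<or> j' = 2" "residue e c (x, y, j') = int i" using comp_nu(2) that False by blast
    ultimately show ?thesis by (auto simp: mem_sig_word)
  next
    case True
    then have "j' = j" "residue e c (x, y, j) = int i" by auto
    then have "(int y - int x + chg c j) mod int e = (int b - int a + chg c j) mod int e"
      using res by (simp add: residue_def content_def)
    then have dvd: "int e dvd (int y - int x) - (int b - int a)" by (simp add: mod_eq_dvd_iff)
    \<comment> \<open>Contents differing by 1 have different residues, so the corners affected by
      the removal are not in this word.\<close>
    have "\<not> int e dvd 1" "\<not> int e dvd - 1" using assms(1) by auto
    then have ne: "int y - int x \<noteq> int b - int a + 1" "int y - int x \<noteq> int b - int a - 1"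
      using dvd by auto
    show ?thesis
      using corner_remove[OF la la'(1,2) ab ne] True j by (cases s) (auto simp: mem_sig_word n comp_nu(1))
  qed
  then have "set (sig_word c e i nu) = insert (True, n) (set (sig_word c e i mu) - {(False, n)})"
    by (metis set_eqI prod.exhaust)
  also have "\<dots> = set (u @ (True, n) # v)" using distinct_sig_word[of c e i mu] by (auto simp: w)
  finally have set: "set (u @ (True, n) # v) = set (sig_word c e i nu)" ..
  have map: "map (key c) (u @ (True, n) # v) = map (key c) (sig_word c e i mu)" by (simp add: w key_def)
  have "sig_word c e i nu = u @ (True, n) # v"
    using inj_on_key_sig_word[OF mu] distinct_sig_word sorted_sig_word
    by (intro sig_word_eqI[OF nu set]) (auto simp only: map distinct_map)
  then show ?thesis using that nu add by blast
qed

text \<open>A final segment of positive excess yields an R whose removal gives a vertex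
  \<open>nu\<close> with this node as its good addable node, hence an edge into
  \<open>mu\<close>.\<close>

lemma highest_weight_excess:
  assumes "1 < e" "highest_weight c e mu" "i < e" "sig_word c e i mu = w1 @ w2"
  shows "excess w2 \<le> 0"
proof (rule ccontr)
  assume "\<not> excess w2 \<le> 0"
  then have "0 < excess w2" by simp
  from positive_excess_flip[OF assms(4) this] obtain u n v "as" where
    w: "sig_word c e i mu = u @ (False, n) # v"
    and as: "filter fst (cancel_RA [] (u @ (True, n) # v)) = as @ [(True, n)]" by metis
  have mu: "is_bipartition mu" using assms(2) by (simp add: highest_weight_def)
  obtain nu where nu: "is_bipartition nu" "add_node nu n = mu" "sig_word c e i nu = u @ (True, n) # v"
    using sig_word_remove[OF assms(1) mu w] by blast
  have "good_addable c e i nu = Some n" by (simp add: good_addable_def nu(3) as Let_def)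
  then have "crystal_edge c e nu i mu" using assms(3) nu(2) by (auto simp: crystal_edge_def)
  then show False using assms(2) nu(1) unfolding highest_weight_def by blast
qed

lemma sorted_filter_ge_suffix:
  fixes f :: "'a \<Rightarrow> 'b :: linorder"
  assumes "sorted (map f w)"
  shows "\<exists>w1. w = w1 @ filter (\<lambda>x. k \<le> f x) w"
  using assms
proof (induction w)
  case (Cons x w)
  show ?case
  proof (cases "k \<le> f x")
    case True
    then have "\<forall>y\<in>set w. k \<le> f y" using Cons.prems by auto
    then show ?thesis using True by simp
  next
    case False
    obtain w1 where "w = w1 @ filter (\<lambda>x. k \<le> f x) w" using Cons by auto
    then show ?thesis using False by (intro exI[of _ "x # w1"]) simp
  qed
qed simp

lemma excess_eq_card:
  assumes "distinct w"
  shows "excess w = int (card {x \<in> set w. \<not> fst x}) - int (card {x \<in> set w. fst x})"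
proof -
  have "excess w = int (length (filter (\<lambda>x. \<not> fst x) w)) - int (length (filter fst w))"
    by (induction w) auto
  then show ?thesis
    using assms distinct_card[of "filter (\<lambda>x. \<not> fst x) w"] distinct_card[of "filter fst w"] by simp
qed

section \<open>Highest weight vertices\<close>

text \<open>The position of a letter among the beads of \<open>Phi t mu\<close>: an addable node moves a bead
  from \<open>z - 2\<close> to \<open>z\<close>, a removable node one from \<open>z\<close> to \<open>z - 2\<close>.\<close>
definition position :: "nat \<Rightarrow> bool \<times> node \<Rightarrow> int" where
  "position t = (\<lambda>(_, a, b, j). if j = 1 then 2 * (int b - int a) + int t + 1 else 2 * (int b - int a) - int t)"

lemma addable_position:
  assumes "is_bipartition mu" "(True, n) \<in> set (sig_word c e i mu)"
  shows "position t (True, n) - 2 \<in> interleave t mu" "position t (True, n) \<notin> interleave t mu"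
proof -
  obtain a b j where n: "n = (a, b, j)" by (cases n)
  have j: "j = 1 \<or> j = 2" and ab: "(a, b) \<in> set (addable (comp mu j))"
    using assms(2) by (auto simp: n mem_sig_word)
  let ?w = "int b - int a"
  have m: "?w - 1 \<in> maya (comp mu j)" "?w \<notin> maya (comp mu j)"
    using addable_maya[OF is_partition_comp[OF assms(1)] ab] by auto
  have "2 * ?w + int t + 1 - 2 = 2 * (?w - 1) + int t + 1" "2 * ?w - int t - 2 = 2 * (?w - 1) - int t"
    by simp_all
  then show "position t (True, n) - 2 \<in> interleave t mu" "position t (True, n) \<notin> interleave t mu"
    using j m by (auto simp only: position_def n prod.case if_True if_False interleave_fst interleave_snd
        comp_def split: if_splits)
qed

lemma removable_position:
  assumes "is_bipartition mu" "z \<in> interleave t mu" "z - 2 \<notin> interleave t mu"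
  obtains a b j where "j = 1 \<or> j = 2" "(a, b) \<in> set (removable (comp mu j))" "position t (False, a, b, j) = z"
proof (cases z rule: int_parity_cases[where t = t])
  case (1 w)
  then have z2: "z - 2 = 2 * (w - 1) + int t + 1" by simp
  have "w \<in> maya (comp mu 1)" "w - 1 \<notin> maya (comp mu 1)"
    using assms(2,3) unfolding z2 unfolding 1 interleave_fst by (simp_all add: comp_def)
  from maya_removable[OF is_partition_comp[OF assms(1)] this]
  obtain a b where "(a, b) \<in> set (removable (comp mu 1))" "int b - int a = w" .
  then show ?thesis using that[of 1 a b] 1 by (simp add: position_def)
next
  case (2 w)
  then have z2: "z - 2 = 2 * (w - 1) - int t" by simp
  have "w \<in> maya (comp mu 2)" "w - 1 \<notin> maya (comp mu 2)"
    using assms(2,3) unfolding z2 unfolding 2 interleave_snd by (simp_all add: comp_def)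
  from maya_removable[OF is_partition_comp[OF assms(1)] this]
  obtain a b where "(a, b) \<in> set (removable (comp mu 2))" "int b - int a = w" .
  then show ?thesis using that[of 2 a b] 2 by (simp add: position_def)
qed

context
  fixes e t :: nat and c :: "int \<times> int"
  assumes e: "1 < e" "odd e" and c: "c = (int t + (1 - int e) div 2, 0)"
begin

text \<open>In component 1 the charge adds 2t + 1 - e to twice the content, whereas the interleaving
  offsets t + 1 and -t differ by 2t + 1. The two components therefore end up e apart.\<close>

lemma position_content:
  assumes "j = 1 \<or> j = 2"
  shows "position t (s, a, b, j) = 2 * content c (a, b, j) - int t + (if j = 1 then int e else 0)"
proof -
  have "2 * ((1 - int e) div 2) = 1 - int e" using e(2) by simp
  then show ?thesis using assms by (auto simp: position_def content_def c chg_def)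
qed

text \<open>Modulo e the offset between the components vanishes, and 2 is invertible; so the nodes
  of one residue, from both components, share one runner.\<close>

lemma residue_iff_position:
  assumes "j = 1 \<or> j = 2" "i < e"
  shows "residue e c (a, b, j) = int i \<longleftrightarrow> position t (s, a, b, j) mod int e = (2 * int i - int t) mod int e"
proof -
  have "residue e c (a, b, j) = int i \<longleftrightarrow> int e dvd content c (a, b, j) - int i"
    using assms(2) by (simp add: residue_def flip: mod_eq_dvd_iff)
  also have "\<dots> \<longleftrightarrow> int e dvd 2 * (content c (a, b, j) - int i)"
    using e(2) by (subst coprime_dvd_mult_right_iff) (auto simp: coprime_commute)
  also have "\<dots> \<longleftrightarrow> int e dvd (if j = 1 then int e else 0) + 2 * (content c (a, b, j) - int i)"
    by (simp add: dvd_add_right_iff)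
  also have "(if j = 1 then int e else 0) + 2 * (content c (a, b, j) - int i)
      = position t (s, a, b, j) - (2 * int i - int t)"
    by (simp add: position_content[OF assms(1)] algebra_simps)
  finally show ?thesis by (simp add: mod_eq_dvd_iff)
qed

text \<open>Distinct contents of one residue differ by at least e, hence by 2e after doubling, which
  outweighs the offset e. At equal contents the tie-break puts component 2 first, and its position
  is the smaller one.\<close>

lemma sorted_position_sig_word: "sorted (map (position t) (sig_word c e i mu))"
proof -
  have "position t x \<le> position t y"
    if mem: "x \<in> set (sig_word c e i mu)" "y \<in> set (sig_word c e i mu)" and le: "key c x \<le> key c y" for x y
  proof -
    obtain s a b j s' a' b' j' where x: "x = (s, a, b, j)" "y = (s', a', b', j')"
      by (metis prod.exhaust)
    have j: "j = 1 \<or> j = 2" "j' = 1 \<or> j' = 2" using mem by (auto simp: x mem_sig_word)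
    let ?k = "content c (a, b, j)" and ?k' = "content c (a', b', j')"
    have le: "2 * ?k + (2 - int j) \<le> 2 * ?k' + (2 - int j')" using le by (simp add: key_def x)
    have "?k mod int e = ?k' mod int e" using mem by (simp add: x mem_sig_word residue_def)
    then have "int e dvd ?k' - ?k" by (metis mod_eq_dvd_iff)
    then have "int e \<le> ?k' - ?k" if "?k < ?k'" using that by (simp add: zdvd_imp_le)
    then show ?thesis unfolding x position_content[OF j(1)] position_content[OF j(2)]
      using j le e(1) by (cases "j = 1"; cases "j' = 1"; simp; linarith?)
  qed
  then show ?thesis
    using sorted_sig_word[of c e i mu] unfolding sorted_map
    by (auto intro: sorted_wrt_mono_rel[rotated])
qed

lemma inj_on_position_sig_word:
  assumes "is_bipartition mu"
  shows "inj_on (position t) (set (sig_word c e i mu))"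
proof (rule inj_onI)
  fix x x' assume mem: "x \<in> set (sig_word c e i mu)" "x' \<in> set (sig_word c e i mu)"
    and eq: "position t x = position t x'"
  obtain s a b j s' a' b' j' where x: "x = (s, a, b, j)" "x' = (s', a', b', j')"
    by (metis prod.exhaust)
  have j: "j = 1 \<or> j = 2" "j' = 1 \<or> j' = 2" using mem by (auto simp: x mem_sig_word)
  have jj: "j = j'" using eq j by (auto simp: x position_def; presburger)
  then have "int b - int a = int b' - int a'" using eq by (simp add: x position_def split: if_splits)
  then have "key c x = key c x'" using jj by (simp add: x key_def content_def)
  then show "x = x'" by (rule inj_onD[OF inj_on_key_sig_word[OF assms] _ mem])
qed

lemma exists_residue: "\<exists>i<e. (2 * int i - int t) mod int e = z mod int e"
proof -
  obtain h where h: "e = 2 * h + 1" using e(2) by (rule oddE)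
  \<comment> \<open>\<open>h + 1\<close> is (e + 1)/2, the inverse of 2 modulo
    \<open>e\<close>.\<close>
  define i where "i = nat (((z + int t) * (int h + 1)) mod int e)"
  have i: "int i = ((z + int t) * (int h + 1)) mod int e" using e(1) by (simp add: i_def)
  have "(2 * int i - int t) mod int e = (2 * ((z + int t) * (int h + 1)) - int t) mod int e"
    unfolding i by (intro mod_diff_cong mod_mult_cong) simp_all
  also have "2 * ((z + int t) * (int h + 1)) - int t = z + (z + int t) * int e"
    by (simp add: h algebra_simps)
  finally have "(2 * int i - int t) mod int e = z mod int e" by simp
  moreover have "i < e" using i e(1) by (metis of_nat_less_iff pos_mod_bound of_nat_0_less_iff less_trans zero_less_one)
  ultimately show ?thesis by blast
qed

lemma highest_weight_runner_count:
  assumes hw: "highest_weight c e mu"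
  shows "runner_count e (interleave t mu) z \<le> runner_count e (interleave t mu) (z - 2)"
proof -
  have mu: "is_bipartition mu" using hw by (simp add: highest_weight_def)
  obtain la where la: "is_partition la" "maya la = interleave t mu"
    using exists_maya_interleave[OF mu] by blast
  define M where "M = interleave t mu"
  have finM: "finite {w \<in> M. x \<le> w}" for x using finite_maya_ge[OF la(1)] la(2) by (simp add: M_def)
  obtain i where i: "i < e" "(2 * int i - int t) mod int e = z mod int e" using exists_residue by blast
  define S where "S = set (sig_word c e i mu)"
  define P where "P = {w \<in> M. z \<le> w \<and> w mod int e = z mod int e}"
  \<comment> \<open>The beads counted at \<open>z - 2\<close>, moved right by 2 so that they can be
    compared with \<open>P\<close> on one runner.\<close>
  define Q where "Q = {w. w - 2 \<in> M \<and> z \<le> w \<and> w mod int e = z mod int e}"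
  let ?rem = "{x \<in> S. \<not> fst x \<and> z \<le> position t x}" and ?add = "{x \<in> S. fst x \<and> z \<le> position t x}"
  have finP: "finite P" by (rule finite_subset[OF _ finM[of z]]) (auto simp: P_def)
  have "Q = (\<lambda>w. w + 2) ` {w \<in> M. z - 2 \<le> w \<and> w mod int e = (z - 2) mod int e}" (is "_ = _ ` ?Q")
  proof -
    have "(w - 2) mod int e = (z - 2) mod int e \<longleftrightarrow> w mod int e = z mod int e" for w
      by (simp add: mod_eq_dvd_iff)
    then show ?thesis by (force simp: Q_def image_iff algebra_simps)
  qed
  moreover have "finite ?Q" by (rule finite_subset[OF _ finM[of "z - 2"]]) auto
  ultimately have finQ: "finite Q" and cQ: "card Q = runner_count e M (z - 2)"
    by (simp_all add: runner_count_def card_image)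
  \<comment> \<open>Points of \<open>P\<close> outside \<open>Q\<close> come from R's, and A's give
    points of \<open>Q\<close> outside \<open>P\<close>; the common part cancels, so the excess
    controls the difference of the two counts.\<close>
  have "P - Q \<subseteq> position t ` ?rem"
  proof
    fix w assume w: "w \<in> P - Q"
    then have "w \<in> interleave t mu" "w - 2 \<notin> interleave t mu" by (auto simp: P_def Q_def M_def)
    from removable_position[OF mu this] obtain a b j where
      j: "j = 1 \<or> j = 2" "(a, b) \<in> set (removable (comp mu j))" "position t (False, a, b, j) = w" .
    have "residue e c (a, b, j) = int i"
      using residue_iff_position[OF j(1) i(1), of a b False] j(3) w i(2) by (simp add: P_def)
    then have "(False, a, b, j) \<in> S" using j by (simp add: S_def mem_sig_word)
    then show "w \<in> position t ` ?rem" using j(3) w by (force simp: P_def)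
  qed
  then have "card (P - Q) \<le> card ?rem" by (rule surj_card_le[rotated]) (simp add: S_def)
  also have "\<dots> \<le> card ?add"
  proof -
    \<comment> \<open>The word is sorted by position as well, so cutting at position
      \<open>z\<close> leaves a final segment.\<close>
    let ?w = "filter (\<lambda>x. z \<le> position t x) (sig_word c e i mu)"
    obtain w1 where "sig_word c e i mu = w1 @ ?w"
      using sorted_filter_ge_suffix[OF sorted_position_sig_word] by blast
    then have "excess ?w \<le> 0" by (rule highest_weight_excess[OF e(1) hw i(1)])
    moreover have "distinct ?w" using distinct_sig_word by (rule distinct_filter)
    ultimately show ?thesis
      using excess_eq_card[of ?w] by (simp add: S_def conj_commute conj_left_commute)
  qed
  also have "\<dots> = card (position t ` ?add)"
    using inj_on_position_sig_word[OF mu, of i] by (intro card_image[symmetric]) (auto simp: S_def inj_on_def)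
  also have "\<dots> \<le> card (Q - P)"
  proof (rule card_mono)
    show "position t ` ?add \<subseteq> Q - P"
    proof (clarsimp)
      fix a b j assume S: "(True, a, b, j) \<in> S" and z: "z \<le> position t (True, a, b, j)"
      have "(j = 1 \<or> j = 2)" "residue e c (a, b, j) = int i" using S by (auto simp: S_def mem_sig_word)
      then have "position t (True, a, b, j) mod int e = z mod int e"
        using residue_iff_position[of j i a b True] i by simp
      then show "position t (True, a, b, j) \<in> Q \<and> position t (True, a, b, j) \<notin> P"
        using addable_position[OF mu, of "(a, b, j)" c e i t] S z by (simp add: P_def Q_def M_def S_def)
    qed
  qed (use finQ in simp)
  finally have "card (P - Q) \<le> card (Q - P)" .
  moreover have "card P = card (P - Q) + card (P \<inter> Q)"
    using finP by (metis add.commute card_Int_Diff)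
  moreover have "card Q = card (Q - P) + card (P \<inter> Q)"
    using finQ by (metis add.commute card_Int_Diff inf_commute)
  ultimately have "card P \<le> card Q" by simp
  then show ?thesis using cQ by (simp add: P_def runner_count_def M_def)
qed

end

theorem theorem7p6:
  fixes e t :: nat and mu :: bipartition
  assumes "e > 1" and "odd e"
    and "is_bipartition mu"
    and "highest_weight (int t + (1 - int e) div 2, 0) e mu"
  shows "is_core 2 (core e (Phi t mu))"
proof (rule is_core_2_core)
  show "is_partition (Phi t mu)" by (rule Phi_maya[OF assms(3)])
  show "2 < e" using assms(1,2) by (cases "e = 2") auto
  show "runner_count e (maya (Phi t mu)) z \<le> runner_count e (maya (Phi t mu)) (z - 2)" for z
    unfolding Phi_maya(2)[OF assms(3)] by (rule highest_weight_runner_count[OF assms(1,2) refl assms(4)])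
qed

end
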